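(* Let $N$ be an integer and $N>p\ge 2$, $0\le b<\frac{N-p}{p}$, $a<\frac{Nb}{N-p}$ and $(p-1)a+b+1=\frac{pbN}{N-p}$. There is a universal constant $C(N,p,b)>0$ (depending only on $N,p,b$) such that for each $u\in\mathcal{C}_0^\infty(\mathbb{R}^N\setminus\{\mathbf{0}\})$, $$\int_{\mathbb{R}^N}\frac{|\nabla u|^p}{|x|^{pb}}\,\mathrm{d}x+(p-1)\int_{\mathbb{R}^N}\frac{|u|^p}{|x|^{pa}}\,\mathrm{d}x-\left[N-(p-1)a-b-1\right]\int_{\mathbb{R}^N}\frac{|u|^p}{|x|^{(p-1)a+b+1}}\,\mathrm{d}x$$ $$\ge C(N,p,b)\inf_{c\in\mathbb{R}}\int_{\mathbb{R}^N}\frac{\left|u-c\,e^{-\frac{|x|^{b-a+1}}{b-a+1}}\right|^p}{|x|^{(p-1)a+b+1}}\,\mathrm{d}x.$$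
   Context: $\mathcal{C}_0^\infty(\mathbb{R}^N\setminus\{\mathbf{0}\})$ is the set of real-valued smooth functions compactly supported in $\mathbb{R}^N\setminus\{\mathbf{0}\}$. *)

theory Defs
  imports "HOL-Analysis.Analysis"
begin

definition partial_derivative :: "'n::finite \<Rightarrow> (real^'n \<Rightarrow> real) \<Rightarrow> real^'n \<Rightarrow> real" where
  "partial_derivative i f x = frechet_derivative f (at x) (axis i 1)"

text \<open>The continuity of the derivative of order \<open>k\<close> is expressed through the continuity of all
  iterated partial derivatives of order \<open>k\<close>.\<close>
primrec C_k :: "nat \<Rightarrow> (real^'n::finite \<Rightarrow> real) \<Rightarrow> bool" where
  "C_k 0 f \<longleftrightarrow> continuous_on UNIV f"
| "C_k (Suc k) f \<longleftrightarrow> f differentiable_on UNIV \<and> (\<forall>i. C_k k (partial_derivative i f))"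

definition smooth :: "(real^'n::finite \<Rightarrow> real) \<Rightarrow> bool" where
  "smooth f \<longleftrightarrow> (\<forall>k. C_k k f)"

text \<open>Functions on the punctured space with compact support there are identified with their
  extension by zero to the whole space; the support is then a compact set avoiding the origin.\<close>
definition test_functions_punctured :: "(real^'n::finite \<Rightarrow> real) set" where
  "test_functions_punctured =
     {u. smooth u \<and> compact (closure {x. u x \<noteq> 0}) \<and> 0 \<notin> closure {x. u x \<noteq> 0}}"

definition gradient :: "(real^'n::finite \<Rightarrow> real) \<Rightarrow> real^'n \<Rightarrow> real^'n" where
  "gradient f x = (THE D. GDERIV f x :> D)"

end

theory Submission
  imports Defs
begin

text \<open>
  Write \<open>r = |x|\<close>, \<open>\<gamma> = (p - 1) a + b + 1\<close>, \<open>\<kappa> = b - a + 1 = \<gamma> - p a\<close>, \<open>U = exp (- r\<^sup>\<kappa> / \<kappa>)\<close> and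
  \<open>W = \<nabla>u + u r\<^bsup>\<kappa> - 2\<^esup> x = U \<nabla>(u / U)\<close>. Integrating the divergence of \<open>|u|\<^sup>p r\<^bsup>- \<gamma>\<^esup> x\<close>
  turns the left-hand side into the integral of \<open>|A|\<^sup>p + (p - 1) |B|\<^sup>p - p |B|\<^bsup>p - 2\<^esup> B \<bullet> A\<close> with
  \<open>A = r\<^bsup>- b\<^esup> \<nabla>u\<close> and \<open>B = - u r\<^bsup>- a\<^esup> x / r\<close>, which by Clarkson's inequality is at least
  \<open>2\<^bsup>1 - p\<^esup> E\<close>, where \<open>E\<close> is the integral of \<open>|A - B|\<^sup>p = |W|\<^sup>p r\<^bsup>- p b\<^esup>\<close>.

  It remains to bound the weighted distance of \<open>u\<close> to \<open>c U\<close> by \<open>E\<close>, a Poincare inequality for \<open>u / U\<close>.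
  A Lyapunov argument, namely integrating the divergence of \<open>h |u - c U|\<^sup>p r\<^bsup>- \<gamma>\<^esup> x\<close> for a radial \<open>h\<close>
  that runs from \<open>-1\<close> at the origin to \<open>1\<close> at infinity, reduces it to a ball without weights. There the
  weight \<open>U\<^sup>p r\<^bsup>- p b\<^esup>\<close> of \<open>E\<close> is bounded below and the classical Poincare inequality applies.
\<close>

subsection \<open>Convexity of powers\<close>

lemma Youngs_inequality_powr:
  fixes p \<alpha> \<beta> :: real
  assumes "1 < p" "0 \<le> \<alpha>" "0 \<le> \<beta>"
  shows "p * \<alpha> powr (p - 1) * \<beta> \<le> (p - 1) * \<alpha> powr p + \<beta> powr p"
proof -
  have "\<alpha> powr (p - 1) * \<beta> \<le> (\<alpha> powr (p - 1)) powr (p / (p - 1)) / (p / (p - 1)) + \<beta> powr p / p"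
    using assms by (intro Youngs_inequality) (auto simp: field_simps)
  also have "(\<alpha> powr (p - 1)) powr (p / (p - 1)) = \<alpha> powr p"
    using assms by (simp add: powr_powr)
  finally show ?thesis
    using assms by (simp add: field_simps)
qed

lemma powr_add_le_powr_add:
  fixes q s t :: real
  assumes "1 \<le> q" "0 \<le> s" "0 \<le> t"
  shows "s powr q + t powr q \<le> (s + t) powr q"
proof -
  have *: "x powr q = x * x powr (q - 1)" if "0 \<le> x" for x :: real
    using that by (cases "x = 0") (auto simp: powr_diff)
  have "s powr q + t powr q = s * s powr (q - 1) + t * t powr (q - 1)"
    using assms by (simp add: *)
  also have "\<dots> \<le> s * (s + t) powr (q - 1) + t * (s + t) powr (q - 1)"
    using assms by (intro add_mono mult_left_mono powr_mono2) auto
  also have "\<dots> = (s + t) powr q"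
    using assms *[of "s + t"] by (simp add: algebra_simps)
  finally show ?thesis .
qed

text \<open>Young's inequality with \<alpha> = m is the tangent line bound at the midpoint m; added
  for s and t, the linear terms combine to 2 q m^q. It needs 1 < q, hence the separate case q =
  1.\<close>

lemma midpoint_powr_le:
  fixes q s t :: real
  assumes q: "1 \<le> q" and st: "0 \<le> s" "0 \<le> t"
  shows "((s + t) / 2) powr q \<le> (s powr q + t powr q) / 2"
proof (cases "q = 1")
  case False
  define m where "m = (s + t) / 2"
  have m: "0 \<le> m" "s + t = 2 * m" using st by (auto simp: m_def)
  have "q * m powr (q - 1) * s + q * m powr (q - 1) * t \<le> 2 * (q - 1) * m powr q + s powr q + t powr q"
    using Youngs_inequality_powr[of q m s] Youngs_inequality_powr[of q m t] q False st m by linarith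
  moreover have "q * m powr (q - 1) * s + q * m powr (q - 1) * t = q * m powr (q - 1) * (2 * m)"
    using m(2) by (simp flip: distrib_left)
  moreover have "q * m powr (q - 1) * (2 * m) = 2 * (q * m powr q)"
    using m by (cases "m = 0") (auto simp: powr_diff)
  ultimately have "2 * m powr q \<le> s powr q + t powr q"
    by (simp only: left_diff_distrib right_diff_distrib mult.assoc)
  then show ?thesis by (simp add: m_def)
qed (use st in auto)

text \<open>The parallelogram law sits between two facts on t^(p/2) with p/2 >= 1: superadditivity
  before it, midpoint convexity after it.\<close>

lemma Clarkson_inequality_pointwise:
  fixes X Y :: "'a::real_inner" and p :: real
  assumes p: "2 \<le> p"
  shows "norm X powr p + norm Y powr p \<le> (norm (X + Y) powr p + norm (X - Y) powr p) / 2"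
proof -
  have sq: "norm Z powr p = (norm Z ^ 2) powr (p / 2)" for Z :: 'a
    by (cases "norm Z = 0") (auto simp: powr_powr simp flip: powr_numeral)
  have par: "norm X ^ 2 + norm Y ^ 2 = (norm (X + Y) ^ 2 + norm (X - Y) ^ 2) / 2"
    by (simp add: power2_norm_eq_inner algebra_simps inner_commute)
  have "norm X powr p + norm Y powr p \<le> (norm X ^ 2 + norm Y ^ 2) powr (p / 2)"
    unfolding sq using p by (intro powr_add_le_powr_add) auto
  also have "\<dots> \<le> ((norm (X + Y) ^ 2) powr (p / 2) + (norm (X - Y) ^ 2) powr (p / 2)) / 2"
    unfolding par using p by (intro midpoint_powr_le) auto
  finally show ?thesis
    by (simp flip: sq)
qed

text \<open>The right-hand side is the gap between |A|^p and the tangent of |.|^p at B = \<beta> e.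
  Clarkson's inequality for X = (A + B)/2 and Y = (A - B)/2 bounds |A|^p + |B|^p from below, the
  tangent at B bounds |X|^p from below, and what is left is 2 |Y|^p = 2^(1-p) |A - B|^p.\<close>

lemma powr_norm_convexity_gap:
  fixes A e :: "'a::real_inner" and p \<beta> :: real
  assumes p: "2 \<le> p" and e: "norm e = 1"
  shows "2 powr (1 - p) * norm (A - \<beta> *\<^sub>R e) powr p
    \<le> norm A powr p + (p - 1) * \<bar>\<beta>\<bar> powr p - p * (sgn \<beta> * \<bar>\<beta>\<bar> powr (p - 1)) * (e \<bullet> A)"
proof -
  define B where "B = \<beta> *\<^sub>R e"
  define X where "X = (1/2) *\<^sub>R (A + B)"
  define Y where "Y = (1/2) *\<^sub>R (A - B)"
  have nB: "norm B = \<bar>\<beta>\<bar>" using e by (simp add: B_def)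
  have XY: "X + Y = A" "X - Y = B"
    by (auto simp: X_def Y_def scaleR_add_right scaleR_diff_right simp flip: scaleR_add_left)
  have ee: "e \<bullet> e = 1" using e by (simp add: dot_square_norm)
  have ab: "sgn \<beta> * \<beta> = \<bar>\<beta>\<bar>" by (simp add: abs_sgn mult.commute)
  have bb: "\<bar>\<beta>\<bar> powr (p - 1) * \<bar>\<beta>\<bar> = \<bar>\<beta>\<bar> powr p"
    by (cases "\<beta> = 0") (auto simp: powr_diff)
  have "\<bar>sgn \<beta> * (e \<bullet> X)\<bar> \<le> norm X"
    using Cauchy_Schwarz_ineq2[of e X] e by (auto simp: abs_mult sgn_if)
  hence *: "sgn \<beta> * (e \<bullet> X) \<le> norm X" by linarith
  have "p * \<bar>\<beta>\<bar> powr (p - 1) * (sgn \<beta> * (e \<bullet> X)) \<le> p * \<bar>\<beta>\<bar> powr (p - 1) * norm X"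
    using p * by (intro mult_left_mono) auto
  also have "\<dots> \<le> (p - 1) * \<bar>\<beta>\<bar> powr p + norm X powr p"
    using p by (intro Youngs_inequality_powr) auto
  finally have 1: "2 * (p * \<bar>\<beta>\<bar> powr (p - 1) * (sgn \<beta> * (e \<bullet> X))) \<le> 2 * (p - 1) * \<bar>\<beta>\<bar> powr p + 2 * norm X powr p"
    by linarith
  have "e \<bullet> X = (e \<bullet> A + \<beta>) / 2"
    by (simp add: X_def B_def inner_add_right ee)
  hence "2 * (p * \<bar>\<beta>\<bar> powr (p - 1) * (sgn \<beta> * (e \<bullet> X)))
    = p * \<bar>\<beta>\<bar> powr (p - 1) * sgn \<beta> * (e \<bullet> A) + p * \<bar>\<beta>\<bar> powr (p - 1) * (sgn \<beta> * \<beta>)"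
    by (simp only:) (simp add: field_simps)
  also have "\<dots> = p * (sgn \<beta> * \<bar>\<beta>\<bar> powr (p - 1)) * (e \<bullet> A) + p * \<bar>\<beta>\<bar> powr p"
    unfolding ab using bb by (simp add: algebra_simps)
  finally have 2: "2 * (p * \<bar>\<beta>\<bar> powr (p - 1) * (sgn \<beta> * (e \<bullet> X))) =
    p * (sgn \<beta> * \<bar>\<beta>\<bar> powr (p - 1)) * (e \<bullet> A) + p * \<bar>\<beta>\<bar> powr p" .
  have 3: "norm X powr p + norm Y powr p \<le> (norm A powr p + \<bar>\<beta>\<bar> powr p) / 2"
    using Clarkson_inequality_pointwise[OF p, of X Y] by (simp add: XY nB)
  have "norm Y powr p = (1/2) powr p * norm (A - B) powr p"
    unfolding Y_def by (simp add: powr_mult powr_divide)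
  also have "2 * \<dots> = 2 powr (1 - p) * norm (A - B) powr p"
    by (simp add: powr_diff powr_divide)
  finally have 4: "2 * norm Y powr p = 2 powr (1 - p) * norm (A - B) powr p" .
  show ?thesis
    using 1 3 unfolding 2 4[unfolded B_def, symmetric] by (simp add: algebra_simps)
qed

lemma DERIV_abs_powr:
  fixes p x :: real
  assumes p: "1 < p"
  shows "((\<lambda>x. \<bar>x\<bar> powr p) has_real_derivative p * (sgn x * \<bar>x\<bar> powr (p - 1))) (at x)"
proof (cases "x = 0")
  case False
  have "((\<lambda>x. \<bar>x\<bar>) has_real_derivative sgn x) (at x)"
    using has_derivative_norm[OF False] 
    by (simp add: has_field_derivative_def mult_commute_abs mult.commute sgn_div_norm real_norm_def[abs_def])
  then show ?thesis
    using False by (auto intro!: derivative_eq_intros simp: mult_ac)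
next
  case True
  \<comment> \<open>At 0 the difference quotient has absolute value |h|^(p-1), which tends to 0
    because p > 1.\<close>
  have "((\<lambda>h::real. \<bar>h\<bar> powr (p - 1)) \<longlongrightarrow> 0) (at 0)"
    using p by (auto intro!: tendsto_eq_intros)
  hence "((\<lambda>h::real. \<bar>h\<bar> powr p / h) \<longlongrightarrow> 0) (at 0)"
  proof (rule Lim_null_comparison[rotated])
    show "\<forall>\<^sub>F h in at 0. norm (\<bar>h\<bar> powr p / h) \<le> \<bar>h\<bar> powr (p - 1)"
      by (auto simp: eventually_at_filter powr_diff)
  qed
  then show ?thesis
    using p True by (simp add: DERIV_def)
qed

text \<open>Jensen's inequality on the unit interval: Young's inequality with \<alpha> = |I| gives
  the tangent line of |.|^p at I, and integrating it over t leaves |I|^p on the left.\<close>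

lemma abs_integral_powr_le:
  fixes q :: "real \<Rightarrow> real" and p I J :: real
  assumes p: "1 < p" and q: "(q has_integral I) {0..1}"
    and qp: "((\<lambda>t. \<bar>q t\<bar> powr p) has_integral J) {0..1}"
  shows "\<bar>I\<bar> powr p \<le> J"
proof -
  have "((\<lambda>t. p * (sgn I * \<bar>I\<bar> powr (p - 1)) * q t - (p - 1) * \<bar>I\<bar> powr p) has_integral
     (p * (sgn I * \<bar>I\<bar> powr (p - 1)) * I - (p - 1) * \<bar>I\<bar> powr p)) {0..1}"
    using has_integral_const_real[of "(p - 1) * \<bar>I\<bar> powr p" 0 1]
    by (intro has_integral_diff has_integral_mult_right[OF q]) simp
  hence "p * (sgn I * \<bar>I\<bar> powr (p - 1)) * I - (p - 1) * \<bar>I\<bar> powr p \<le> J"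
  proof (rule has_integral_le[OF _ qp])
    fix t
    have "p * (\<bar>I\<bar> powr (p - 1)) * (sgn I * q t) \<le> p * (\<bar>I\<bar> powr (p - 1)) * \<bar>q t\<bar>"
      using p by (intro mult_left_mono) (auto simp: sgn_if)
    also have "\<dots> \<le> (p - 1) * \<bar>I\<bar> powr p + \<bar>q t\<bar> powr p"
      using p by (intro Youngs_inequality_powr) auto
    finally show "p * (sgn I * \<bar>I\<bar> powr (p - 1)) * q t - (p - 1) * \<bar>I\<bar> powr p \<le> \<bar>q t\<bar> powr p"
      by (simp add: mult_ac)
  qed
  moreover have "p * (sgn I * \<bar>I\<bar> powr (p - 1)) * I = p * \<bar>I\<bar> powr p"
    by (cases "I = 0") (auto simp: powr_diff sgn_if)
  ultimately show ?thesis
    by (simp only: left_diff_distrib right_diff_distrib)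
qed

subsection \<open>Dilations and weighted integrals\<close>

lemma nn_integral_lborel_affine:
  fixes f :: "'a::euclidean_space \<Rightarrow> ennreal" and t :: 'a and c :: real
  assumes [measurable]: "f \<in> borel_measurable borel" and c: "c \<noteq> 0"
  shows "(\<integral>\<^sup>+x. f x \<partial>lborel) = ennreal (\<bar>c\<bar> ^ DIM('a)) * (\<integral>\<^sup>+x. f (t + c *\<^sub>R x) \<partial>lborel)"
  by (subst lborel_affine[OF c, of t])
     (simp add: nn_integral_density nn_integral_distr nn_integral_cmult)

lemma lborel_integral_scaleR:
  fixes f :: "'a::euclidean_space \<Rightarrow> real" and c :: real
  assumes [measurable]: "f \<in> borel_measurable borel" and c: "c > 0"
  shows "integrable lborel (\<lambda>x. f (c *\<^sub>R x)) \<longleftrightarrow> integrable lborel f"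
    and "(\<integral>x. f (c *\<^sub>R x) \<partial>lborel) = (\<integral>x. f x \<partial>lborel) / c ^ DIM('a)"
proof -
  have *: "lborel = density (distr lborel borel (\<lambda>x::'a. c *\<^sub>R x)) (\<lambda>_. ennreal (c ^ DIM('a)))"
    using lborel_affine[of c "0::'a"] c by simp
  show "integrable lborel (\<lambda>x. f (c *\<^sub>R x)) \<longleftrightarrow> integrable lborel f"
    using c by (subst (2) *) (simp add: integrable_density integrable_distr_eq)
  have "(\<integral>x. f x \<partial>lborel) = c ^ DIM('a) * (\<integral>x. f (c *\<^sub>R x) \<partial>lborel)"
    using c by (subst *) (simp add: integral_density integral_distr)
  then show "(\<integral>x. f (c *\<^sub>R x) \<partial>lborel) = (\<integral>x. f x \<partial>lborel) / c ^ DIM('a)"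
    using c by simp
qed

text \<open>The divergence theorem for the radial field \<open>F(x) x\<close>: differentiate the scaling law
  \<open>s\<^sup>n \<integral>F(s x) dx = \<integral>F\<close>, in the integrated form over \<open>1 \<le> s \<le> 2\<close> that only needs Fubini.\<close>
lemma integral_dilation_derivative_eq_0:
  fixes F D :: "'a::euclidean_space \<Rightarrow> real"
  assumes F: "integrable lborel F" and D: "integrable lborel D"
    and cont: "continuous_on (- {0}) D"
    and deriv: "\<And>x. x \<noteq> 0 \<Longrightarrow> ((\<lambda>s. F (s *\<^sub>R x)) has_real_derivative D x) (at 1)"
  shows "(\<integral>x. real DIM('a) * F x + D x \<partial>lborel) = 0"
proof -
  define n where "n = DIM('a)"
  have n: "n > 0" by (simp add: n_def)
  define G where "G x = real n * F x + D x" for x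
  have [measurable]: "F \<in> borel_measurable borel" "D \<in> borel_measurable borel"
    using F D by (auto dest: borel_measurable_integrable)
  have [measurable]: "G \<in> borel_measurable borel" unfolding G_def by measurable
  have G: "integrable lborel G" unfolding G_def using F D by auto
  \<comment> \<open>On 1 <= s <= 2 this is the s-derivative of s^n F(s x). Its s-integral is 2^n F(2
    x) - F(x), whose x-integral vanishes by scaling; its x-integral is that of G divided by s.
    Fubini then shows that the integral of G times ln 2 is 0.\<close>
  define H where "H = (\<lambda>(s::real, x). indicator {1..2} s * (s ^ (n - 1) * G (s *\<^sub>R x)))"
  have [measurable]: "H \<in> borel_measurable (borel \<Otimes>\<^sub>M borel)" unfolding H_def by measurable
  have dF: "((\<lambda>s. F (s *\<^sub>R x)) has_real_derivative D (s *\<^sub>R x) / s) (at s)" if "x \<noteq> 0" "s > 0" for x s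
  proof -
    have "((\<lambda>s. F (s *\<^sub>R (s' *\<^sub>R x))) has_real_derivative D (s' *\<^sub>R x)) (at (s / s'))" if "s' = s" for s'
      using deriv[of "s *\<^sub>R x"] \<open>x \<noteq> 0\<close> \<open>s > 0\<close> that by simp
    note * = this[OF refl]
    have "((\<lambda>t. F ((t / s) *\<^sub>R (s *\<^sub>R x))) has_real_derivative D (s *\<^sub>R x) * (1 / s)) (at s)"
      by (rule DERIV_chain'[where f = "\<lambda>t. t / s" and g = "\<lambda>s'. F (s' *\<^sub>R (s *\<^sub>R x))", OF _ *])
         (use \<open>s > 0\<close> in \<open>auto intro!: derivative_eq_intros\<close>)
    then show ?thesis using \<open>s > 0\<close> by simp
  qed
  have contF: "continuous_on {1..2} (\<lambda>s. F (s *\<^sub>R x))" if "x \<noteq> 0" for x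
  proof (rule DERIV_atLeastAtMost_imp_continuous_on)
    show "\<exists>y. ((\<lambda>s. F (s *\<^sub>R x)) has_real_derivative y) (at s)" if "1 \<le> s" "s \<le> 2" for s
      using dF[OF \<open>x \<noteq> 0\<close>, of s] that by (intro exI) simp
  qed
  have dG: "((\<lambda>s. s ^ n * F (s *\<^sub>R x)) has_real_derivative s ^ (n - 1) * G (s *\<^sub>R x)) (at s)"
    if "x \<noteq> 0" "s > 0" for x s
  proof -
    have "s ^ n = s * s ^ (n - 1)" using n by (simp flip: power_Suc)
    then show ?thesis
      using that by (auto intro!: derivative_eq_intros dF simp: G_def field_simps)
  qed
  have inner: "has_bochner_integral lborel (\<lambda>s. H (s, x)) (2 ^ n * F (2 *\<^sub>R x) - F x)" if "x \<noteq> 0" for x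
  proof -
    have "has_bochner_integral lborel (\<lambda>s. indicator {1..2} s *\<^sub>R (s ^ (n - 1) * G (s *\<^sub>R x)))
      (2 ^ n * F (2 *\<^sub>R x) - 1 ^ n * F (1 *\<^sub>R x))"
    proof (rule has_bochner_integral_FTC_Icc)
      show "continuous_on {1..2} (\<lambda>s. s ^ (n - 1) * G (s *\<^sub>R x))"
        unfolding G_def using that contF[OF that]
        by (intro continuous_intros continuous_on_compose2[OF cont]) auto
      show "((\<lambda>s. s ^ n * F (s *\<^sub>R x)) has_vector_derivative s ^ (n - 1) * G (s *\<^sub>R x)) (at s within {1..2})"
        if "1 \<le> s" for s
        using dG[OF \<open>x \<noteq> 0\<close>, of s] that
        by (auto simp: has_real_derivative_iff_has_vector_derivative intro: has_vector_derivative_at_within)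
    qed simp
    then show ?thesis by (simp add: H_def)
  qed
  have Gs: "integrable lborel (\<lambda>x. G (s *\<^sub>R x))" "(\<integral>x. G (s *\<^sub>R x) \<partial>lborel) = (\<integral>x. G x \<partial>lborel) / s ^ n"
     "(\<integral>x. norm (G (s *\<^sub>R x)) \<partial>lborel) = (\<integral>x. norm (G x) \<partial>lborel) / s ^ n"
    if "s \<ge> 1" for s
    using lborel_integral_scaleR[of G s] lborel_integral_scaleR[of "\<lambda>x. norm (G x)" s] that G by (auto simp: n_def)
  have s_pow: "s ^ (n - 1) * (c / s ^ n) = c / s" if "s \<ge> 1" for s c :: real
    using that n by (cases n) auto
  have eqH: "(\<integral>x. H (s, x) \<partial>lborel) = indicator {1..2} s *\<^sub>R ((\<integral>x. G x \<partial>lborel) / s)"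
    "(\<integral>x. norm (H (s, x)) \<partial>lborel) = indicator {1..2} s *\<^sub>R ((\<integral>x. norm (G x) \<partial>lborel) / s)"
    "integrable lborel (\<lambda>x. H (s, x))" for s
    using Gs[of s] s_pow[of s] by (auto simp: H_def indicator_def abs_mult)
  have ln: "has_bochner_integral lborel (\<lambda>s. indicator {1..2} s *\<^sub>R (c / s)) (c * ln 2 - c * ln 1)" for c :: real
    by (rule has_bochner_integral_FTC_Icc)
       (auto intro!: derivative_eq_intros continuous_intros simp flip: has_real_derivative_iff_has_vector_derivative)
  have "integrable (lborel \<Otimes>\<^sub>M lborel) H"
  proof (rule lborel_pair.Fubini_integrable)
    show "integrable lborel (\<lambda>s. \<integral>x. norm (H (s, x)) \<partial>lborel)"
      unfolding eqH by (rule integrable.intros[OF ln])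
  qed (auto simp: eqH)
  then have "(\<integral>x. (\<integral>s. H (s, x) \<partial>lborel) \<partial>lborel) = (\<integral>s. (\<integral>x. H (s, x) \<partial>lborel) \<partial>lborel)"
    using lborel_pair.Fubini_integral[of "\<lambda>s x. H (s, x)"] by simp
  also have "\<dots> = (\<integral>x. G x \<partial>lborel) * ln 2"
    using ln[of "\<integral>x. G x \<partial>lborel"] by (simp add: eqH has_bochner_integral_iff)
  also have "(\<integral>x. (\<integral>s. H (s, x) \<partial>lborel) \<partial>lborel) = (\<integral>x. 2 ^ n * F (2 *\<^sub>R x) - F x \<partial>lborel)"
    using inner
    by (intro integral_cong_AE)
       (auto simp: has_bochner_integral_iff intro!: eventually_mono[OF AE_lborel_singleton[of 0]])
  also have "\<dots> = 0"
    using lborel_integral_scaleR[of F 2] F by (simp add: n_def)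
  finally show ?thesis by (simp add: G_def n_def)
qed

section \<open>Integrability of powers of the norm\<close>

text \<open>f lies below the series of the constants \<open>c k\<close> on the balls of radius
  \<open>R k\<close>, whose integrals are summable. With dyadic radii this replaces polar
  coordinates.\<close>

lemma integrable_cball_cover:
  fixes f :: "'a::euclidean_space \<Rightarrow> real" and c R :: "nat \<Rightarrow> real"
  assumes f[measurable]: "f \<in> borel_measurable borel" and nonneg: "\<And>x. 0 \<le> f x"
    and c: "\<And>k. 0 \<le> c k" and R: "\<And>k. 0 \<le> R k"
    and cover: "\<And>x. f x \<noteq> 0 \<Longrightarrow> \<exists>k. norm x \<le> R k \<and> f x \<le> c k"
    and summ: "summable (\<lambda>k. c k * R k ^ DIM('a))"
  shows "integrable lborel f"
proof (rule integrableI_nonneg)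
  define V where "V = unit_ball_vol (real DIM('a))"
  have "(\<integral>\<^sup>+x. ennreal (f x) \<partial>lborel) \<le> (\<integral>\<^sup>+x. (\<Sum>k. ennreal (c k) * indicator (cball (0::'a) (R k)) x) \<partial>lborel)"
  proof (rule nn_integral_mono)
    fix x :: 'a
    show "ennreal (f x) \<le> (\<Sum>k. ennreal (c k) * indicator (cball 0 (R k)) x)"
    proof (cases "f x = 0")
      case False
      from cover[OF this] obtain k where k: "norm x \<le> R k" "f x \<le> c k" by auto
      have "ennreal (f x) \<le> (\<Sum>j\<in>{k}. ennreal (c j) * indicator (cball 0 (R j)) x)"
        using k by (simp add: ennreal_leI)
      also have "\<dots> \<le> (\<Sum>k. ennreal (c k) * indicator (cball 0 (R k)) x)"
        by (rule sum_le_suminf) auto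
      finally show ?thesis .
    qed simp
  qed
  also have "\<dots> = (\<Sum>k. \<integral>\<^sup>+x. ennreal (c k) * indicator (cball (0::'a) (R k)) x \<partial>lborel)"
    by (rule nn_integral_suminf) (auto intro!: borel_measurable_times_ennreal borel_measurable_indicator)
  also have "\<dots> = (\<Sum>k. ennreal (V * (c k * R k ^ DIM('a))))"
    using c R by (intro suminf_cong) (simp add: nn_integral_cmult_indicator emeasure_cball V_def mult_ac flip: ennreal_mult')
  also have "\<dots> < \<infinity>"
    using summ c R
    by (subst suminf_ennreal2) (auto simp: V_def intro!: mult_nonneg_nonneg summable_mult unit_ball_vol_nonneg)
  finally show "(\<integral>\<^sup>+x. ennreal (f x) \<partial>lborel) < \<infinity>" .
qed (use nonneg in auto)

lemma powr_minus_antimono: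
  fixes a b x :: real
  assumes "0 < a" "a \<le> b" "0 \<le> s"
  shows "b powr - s \<le> a powr - s"
  using assms by (simp add: powr_minus le_imp_inverse_le powr_mono2)

lemma integrable_norm_powr_near_0:
  fixes s :: real
  assumes s: "0 \<le> s" "s < DIM('a::euclidean_space)"
  shows "integrable lborel (\<lambda>x::'a. indicator (cball 0 1) x * norm x powr - s)"
proof (rule integrable_cball_cover[where c = "\<lambda>k. 2 powr s * (2 powr s) ^ k" and R = "\<lambda>k. (1/2) ^ k"])
  fix x :: 'a
  assume nz: "indicator (cball 0 1) x * norm x powr - s \<noteq> 0"
  define r where "r = norm x"
  have r: "0 < r" "r \<le> 1" using nz by (auto simp: r_def indicator_def split: if_splits)
  \<comment> \<open>The dyadic shell 2^(-k-1) < r <= 2^(-k). Its outer radius gives the ball, its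
    inner one bounds r^(-s), hence the extra factor \<open>2 powr s\<close>.\<close>
  define k where "k = nat \<lfloor>- log 2 r\<rfloor>"
  have "log 2 r \<le> 0" using r by (subst log_le_zero_cancel_iff) auto
  then have k: "real k \<le> - log 2 r" "- log 2 r < real k + 1"
    unfolding k_def by linarith+
  have "r \<le> 2 powr (- real k)"
    using k r by (subst log_le_iff[symmetric]) auto
  then have 1: "r \<le> (1/2) ^ k" by (simp add: powr_minus powr_realpow power_one_over inverse_eq_divide)
  have "2 powr (- (real k + 1)) \<le> r"
    using k r by (subst le_log_iff[symmetric]) auto
  then have "r powr - s \<le> (2 powr (- (real k + 1))) powr - s"
    using s by (intro powr_minus_antimono) auto
  also have "\<dots> = 2 powr s * (2 powr s) ^ k"
    by (simp add: powr_powr algebra_simps powr_add flip: powr_realpow)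
  finally show "\<exists>k. norm x \<le> (1/2) ^ k \<and> indicator (cball 0 1) x * norm x powr - s \<le> 2 powr s * (2 powr s) ^ k"
    using 1 r by (auto simp: r_def)
next
  have "(2::real) powr s * (1/2) ^ DIM('a) = 2 powr (s - DIM('a))"
    by (simp add: powr_diff powr_realpow power_one_over)
  also have "\<dots> < 2 powr 0" using s by (subst powr_less_cancel_iff) auto
  finally have "summable (\<lambda>k. 2 powr s * (2 powr s * (1/2) ^ DIM('a)) ^ k)"
    by (intro summable_mult summable_geometric) auto
  then show "summable (\<lambda>k. 2 powr s * (2 powr s) ^ k * ((1 / 2) ^ k) ^ DIM('a))"
    by (simp add: power_mult_distrib mult_ac flip: power_mult)
qed (auto intro!: borel_measurable_times borel_measurable_indicator)

lemma integrable_norm_powr_at_infinity: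
  fixes s :: real
  assumes s: "DIM('a::euclidean_space) < s"
  shows "integrable lborel (\<lambda>x::'a. indicator (- ball 0 1) x * norm x powr - s)"
proof (rule integrable_cball_cover[where c = "\<lambda>k. (2 powr - s) ^ k" and R = "\<lambda>k. 2 ^ Suc k"])
  fix x :: 'a
  assume nz: "indicator (- ball 0 1) x * norm x powr - s \<noteq> 0"
  define r where "r = norm x"
  have r: "1 \<le> r" using nz by (auto simp: r_def indicator_def split: if_splits)
  \<comment> \<open>The shell 2^k <= r < 2^(k+1): the ball takes the outer radius, the bound on
    r^(-s) the inner one.\<close>
  define k where "k = nat \<lfloor>log 2 r\<rfloor>"
  have "log 2 r \<ge> 0" using r by auto
  then have k: "real k \<le> log 2 r" "log 2 r < real k + 1"
    unfolding k_def by linarith+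
  have "r \<le> 2 powr (real k + 1)"
    using k r by (subst log_le_iff[symmetric]) auto
  then have 1: "r \<le> 2 ^ Suc k" by (simp add: powr_add powr_realpow)
  have "2 powr real k \<le> r"
    using k r by (subst le_log_iff[symmetric]) auto
  then have "r powr - s \<le> (2 powr real k) powr - s"
    using s by (intro powr_minus_antimono) auto
  also have "\<dots> = (2 powr - s) ^ k"
    by (simp add: powr_powr algebra_simps flip: powr_realpow)
  finally show "\<exists>k. norm x \<le> 2 ^ Suc k \<and> indicator (- ball 0 1) x * norm x powr - s \<le> (2 powr - s) ^ k"
    using 1 r by (auto simp: r_def)
next
  have "(2::real) powr - s * 2 ^ DIM('a) = 2 powr (DIM('a) - s)"
    by (simp add: powr_diff powr_realpow powr_minus field_simps)
  also have "\<dots> < 2 powr 0" using s by (subst powr_less_cancel_iff) auto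
  finally have "summable (\<lambda>k. 2 ^ DIM('a) * ((2::real) powr - s * 2 ^ DIM('a)) ^ k)"
    by (intro summable_mult summable_geometric) auto
  then show "summable (\<lambda>k. (2 powr - s) ^ k * ((2::real) ^ Suc k) ^ DIM('a))"
    by (simp add: power_mult_distrib mult_ac flip: power_mult)
qed (auto intro!: borel_measurable_times borel_measurable_indicator)

lemma integrable_norm_powr_bounds:
  fixes f :: "'a::euclidean_space \<Rightarrow> real" and C s s' :: real
  assumes [measurable]: "f \<in> borel_measurable borel" and "0 \<le> C"
    and s: "0 \<le> s" "s < DIM('a)" and s': "DIM('a) < s'"
    and near: "\<And>x. x \<noteq> 0 \<Longrightarrow> norm x \<le> 1 \<Longrightarrow> \<bar>f x\<bar> \<le> C * norm x powr - s"
    and far: "\<And>x. 1 \<le> norm x \<Longrightarrow> \<bar>f x\<bar> \<le> C * norm x powr - s'"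
  shows "integrable lborel f"
proof (rule Bochner_Integration.integrable_bound)
  show "integrable lborel (\<lambda>x::'a. C * (indicator (cball 0 1) x * norm x powr - s) + C * (indicator (- ball 0 1) x * norm x powr - s'))"
    using s s' by (intro Bochner_Integration.integrable_add integrable_mult_right
        integrable_norm_powr_near_0 integrable_norm_powr_at_infinity)
  \<comment> \<open>Only almost everywhere: \<open>0 powr - s\<close> is 0, so the comparison
    function vanishes at the origin, where f need not.\<close>
  show "AE x in lborel. norm (f x) \<le> norm (C * (indicator (cball 0 1) x * norm x powr - s) + C * (indicator (- ball 0 1) x * norm x powr - s'))"
  proof (rule eventually_mono[OF AE_lborel_singleton[of 0]])
    fix x :: 'a
    assume "x \<noteq> 0"
    then show "norm (f x) \<le> norm (C * (indicator (cball 0 1) x * norm x powr - s) + C * (indicator (- ball 0 1) x * norm x powr - s'))"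
      using near[of x] far[of x] \<open>0 \<le> C\<close> by (cases "norm x < 1"; cases "norm x = 1") auto
  qed
qed measurable

subsection \<open>The Poincare inequality on a ball\<close>

text \<open>v x - v y is the integral of the directional derivative along the segment from y to x;
  \<open>abs_integral_powr_le\<close> takes the power inside and Cauchy-Schwarz separates |x - y|
  from |V|.\<close>

lemma segment_average_bound:
  fixes v :: "'a::euclidean_space \<Rightarrow> real" and V :: "'a \<Rightarrow> 'a"
  assumes p: "1 < p"
    and deriv: "\<And>x. (v has_derivative (\<lambda>h. V x \<bullet> h)) (at x)"
    and cont: "continuous_on UNIV V"
  shows "ennreal (\<bar>v x - v y\<bar> powr p)
    \<le> (\<integral>\<^sup>+t. ennreal (dist x y powr p * norm (V (y + t *\<^sub>R (x - y))) powr p) * indicator {0..1} t \<partial>lborel)"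
proof -
  define w where "w t = y + t *\<^sub>R (x - y)" for t :: real
  define q where "q t = V (w t) \<bullet> (x - y)" for t
  have contw: "continuous_on {0..1} (\<lambda>t. V (w t))"
    by (intro continuous_on_compose2[OF cont]) (auto simp: w_def intro!: continuous_intros)
  have "(q has_integral v (w 1) - v (w 0)) {0..1}"
  proof (rule fundamental_theorem_of_calculus)
    fix t :: real
    have "(w has_derivative (\<lambda>h. h *\<^sub>R (x - y))) (at t within {0..1})"
      unfolding w_def by (auto intro!: derivative_eq_intros)
    from has_derivative_compose[OF this deriv]
    show "((\<lambda>t. v (w t)) has_vector_derivative q t) (at t within {0..1})"
      by (simp add: has_vector_derivative_def q_def)
  qed simp
  then have q: "(q has_integral v x - v y) {0..1}" by (simp add: w_def)
  have qp: "((\<lambda>t. \<bar>q t\<bar> powr p) has_integral integral {0..1} (\<lambda>t. \<bar>q t\<bar> powr p)) {0..1}"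
    unfolding q_def using p
    by (intro integrable_integral integrable_continuous_real continuous_on_powr' continuous_intros contw) auto
  have Vp: "((\<lambda>t. dist x y powr p * norm (V (w t)) powr p) has_integral
     integral {0..1} (\<lambda>t. dist x y powr p * norm (V (w t)) powr p)) {0..1}"
    using p by (intro integrable_integral integrable_continuous_real continuous_intros continuous_on_powr' contw) auto
  have "\<bar>v x - v y\<bar> powr p \<le> integral {0..1} (\<lambda>t. \<bar>q t\<bar> powr p)"
    by (rule abs_integral_powr_le[OF p q qp])
  also have "\<dots> \<le> integral {0..1} (\<lambda>t. dist x y powr p * norm (V (w t)) powr p)"
  proof (rule has_integral_le[OF qp Vp])
    fix t
    have "\<bar>q t\<bar> \<le> norm (V (w t)) * norm (x - y)"
      unfolding q_def by (rule Cauchy_Schwarz_ineq2)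
    then have "\<bar>q t\<bar> powr p \<le> (norm (V (w t)) * norm (x - y)) powr p"
      using p by (intro powr_mono2) auto
    then show "\<bar>q t\<bar> powr p \<le> dist x y powr p * norm (V (w t)) powr p"
      by (simp add: powr_mult dist_norm mult.commute)
  qed
  finally have "ennreal (\<bar>v x - v y\<bar> powr p) \<le> ennreal (integral {0..1} (\<lambda>t. dist x y powr p * norm (V (w t)) powr p))"
    by (rule ennreal_leI)
  also have "\<dots> = (\<integral>\<^sup>+t. ennreal (dist x y powr p * norm (V (w t)) powr p) * indicator {0..1} t \<partial>lborel)"
    by (rule nn_integral_has_integral_lebesgue'[symmetric]) (use Vp in auto)
  finally show ?thesis by (simp add: w_def)
qed

text \<open>For fixed y the substitution z = y + t (x - y) has Jacobian t^n, n the dimension, and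
  convexity keeps z in B. For t >= 1/2 the inverse Jacobian is at most 2^n; this uniformity in t is
  what allows integrating over t afterwards.\<close>

lemma nn_integral_convex_combination_le:
  fixes g :: "'a::euclidean_space \<Rightarrow> ennreal" and B :: "'a set"
  assumes [measurable]: "g \<in> borel_measurable borel" "B \<in> sets borel"
    and conv: "convex B" and t: "0 \<le> t" "t \<le> 1"
  shows "(\<integral>\<^sup>+y. \<integral>\<^sup>+x. g (y + t *\<^sub>R (x - y)) * indicator B x * indicator B y \<partial>lborel \<partial>lborel)
    \<le> 2 ^ DIM('a) * (\<integral>\<^sup>+x. g x * indicator B x \<partial>lborel) * emeasure lborel B"
proof -
  define A where "A = (\<integral>\<^sup>+x. g x * indicator B x \<partial>lborel)"
  \<comment> \<open>For \<open>t \<ge> 1/2\<close> the substitution is in \<open>x\<close>; smaller \<open>t\<close> follow by exchanging \<open>x\<close> and \<open>y\<close>.\<close>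
  have *: "(\<integral>\<^sup>+y. \<integral>\<^sup>+x. g (y + t *\<^sub>R (x - y)) * indicator B x * indicator B y \<partial>lborel \<partial>lborel)
    \<le> 2 ^ DIM('a) * A * emeasure lborel B" if t: "1/2 \<le> t" "t \<le> 1" for t
  proof -
    have "(\<integral>\<^sup>+x. g (y + t *\<^sub>R (x - y)) * indicator B x * indicator B y \<partial>lborel)
      \<le> 2 ^ DIM('a) * A * indicator B y" for y
    proof (cases "y \<in> B")
      case True
      define J where "J = (\<integral>\<^sup>+x. g ((1 - t) *\<^sub>R y + t *\<^sub>R x) * indicator B ((1 - t) *\<^sub>R y + t *\<^sub>R x) \<partial>lborel)"
      have "(\<integral>\<^sup>+x. g (y + t *\<^sub>R (x - y)) * indicator B x \<partial>lborel) \<le> J"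
        unfolding J_def
      proof (rule nn_integral_mono)
        fix x
        have "y + t *\<^sub>R (x - y) = (1 - t) *\<^sub>R y + t *\<^sub>R x"
          by (simp add: scaleR_diff_right scaleR_diff_left)
        then show "g (y + t *\<^sub>R (x - y)) * indicator B x
          \<le> g ((1 - t) *\<^sub>R y + t *\<^sub>R x) * indicator B ((1 - t) *\<^sub>R y + t *\<^sub>R x)"
          using convexD[OF conv True, of x "1 - t" t] t
          by (cases "x \<in> B") simp_all
      qed
      \<comment> \<open>The inserted factor is at least 1 since 2 t >= 1. Its t^n is the Jacobian of
        the substitution, its 2^n stays in the constant.\<close>
      also have "J \<le> ennreal ((2 * t) ^ DIM('a)) * J"
        using mult_right_mono[of "ennreal 1" "ennreal ((2 * t) ^ DIM('a))" J] t one_le_power[of "2 * t" "DIM('a)"]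
        by (simp add: ennreal_leI del: ennreal_1) (simp add: ennreal_1)
      also have "\<dots> = 2 ^ DIM('a) * (ennreal (\<bar>t\<bar> ^ DIM('a)) * J)"
        using t by (simp add: power_mult_distrib ennreal_mult ennreal_power mult.assoc flip: ennreal_numeral)
      also have "ennreal (\<bar>t\<bar> ^ DIM('a)) * J = A"
        unfolding A_def J_def using t
        by (subst nn_integral_lborel_affine[of _ t "(1 - t) *\<^sub>R y"]) auto
      finally show ?thesis using True by simp
    qed simp
    then have "(\<integral>\<^sup>+y. \<integral>\<^sup>+x. g (y + t *\<^sub>R (x - y)) * indicator B x * indicator B y \<partial>lborel \<partial>lborel)
      \<le> (\<integral>\<^sup>+y. 2 ^ DIM('a) * A * indicator B y \<partial>lborel)"
      by (intro nn_integral_mono)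
    then show ?thesis by (simp add: nn_integral_cmult)
  qed
  show ?thesis
  proof (cases "1/2 \<le> t")
    case False
    have "(\<integral>\<^sup>+y. \<integral>\<^sup>+x. g (y + t *\<^sub>R (x - y)) * indicator B x * indicator B y \<partial>lborel \<partial>lborel)
      = (\<integral>\<^sup>+x. \<integral>\<^sup>+y. g (y + t *\<^sub>R (x - y)) * indicator B x * indicator B y \<partial>lborel \<partial>lborel)"
      by (rule lborel_pair.Fubini') measurable
    also have "\<dots> = (\<integral>\<^sup>+x. \<integral>\<^sup>+y. g (x + (1 - t) *\<^sub>R (y - x)) * indicator B y * indicator B x \<partial>lborel \<partial>lborel)"
      by (simp add: algebra_simps)
    finally show ?thesis using *[of "1 - t"] False t by (simp add: A_def)
  qed (use *[of t] t in \<open>simp add: A_def\<close>)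
qed

text \<open>Averaging over \<open>y\<close> as well as \<open>x\<close> makes the constant \<open>v y\<close> range over all values of \<open>v\<close>, so that an
  infimum over constants can be bounded without selecting one of them.\<close>
lemma Poincare_cball:
  fixes v :: "'a::euclidean_space \<Rightarrow> real" and V :: "'a \<Rightarrow> 'a"
  assumes p: "1 < p" and R: "0 < R"
    and deriv: "\<And>x. (v has_derivative (\<lambda>h. V x \<bullet> h)) (at x)"
    and cont: "continuous_on UNIV V"
    and k: "\<And>y. y \<in> cball 0 R \<Longrightarrow> k \<le> (\<integral>x. indicator (cball 0 R) x * \<bar>v x - v y\<bar> powr p \<partial>lborel)"
  shows "k \<le> 2 ^ DIM('a) * (2 * R) powr p * (\<integral>x. indicator (cball 0 R) x * norm (V x) powr p \<partial>lborel)"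
proof -
  define B where "B = cball (0::'a) R"
  define n where "n = DIM('a)"
  define A where "A = (\<integral>x. indicator B x * norm (V x) powr p \<partial>lborel)"
  have contv: "continuous_on UNIV v"
    using deriv by (auto intro!: continuous_at_imp_continuous_on has_derivative_continuous)
  have [measurable]: "v \<in> borel_measurable borel" "V \<in> borel_measurable borel" "B \<in> sets borel"
    using contv cont by (auto simp: B_def intro!: borel_measurable_continuous_onI)
  have convB: "convex B" by (simp add: B_def)
  have A_nonneg: "0 \<le> A" unfolding A_def by (intro integral_nonneg_AE) auto
  have "integrable lborel (\<lambda>x. indicator B x *\<^sub>R (norm (V x) powr p))"
    unfolding B_def using p
    by (intro borel_integrable_compact continuous_on_powr' continuous_intros continuous_on_subset[OF cont]) auto
  then have A: "(\<integral>\<^sup>+x. ennreal (norm (V x) powr p) * indicator B x \<partial>lborel) = ennreal A"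
    unfolding A_def by (subst nn_integral_eq_integral[symmetric])
      (auto intro!: nn_integral_cong simp: indicator_def)
  have B: "emeasure lborel B \<noteq> 0" "emeasure lborel B \<noteq> \<infinity>"
    using R unit_ball_vol_pos[of "real n"] by (simp_all add: B_def emeasure_cball n_def less_imp_neq[symmetric])
  have kB: "ennreal k * indicator B y \<le> (\<integral>\<^sup>+x. ennreal (\<bar>v x - v y\<bar> powr p) * indicator B x * indicator B y \<partial>lborel)" for y
  proof (cases "y \<in> B")
    case True
    have "integrable lborel (\<lambda>x. indicator B x *\<^sub>R (\<bar>v x - v y\<bar> powr p))"
      unfolding B_def using p
      by (intro borel_integrable_compact continuous_on_powr' continuous_intros continuous_on_subset[OF contv]) auto
    then have "(\<integral>\<^sup>+x. ennreal (\<bar>v x - v y\<bar> powr p) * indicator B x \<partial>lborel) = ennreal (\<integral>x. indicator B x * \<bar>v x - v y\<bar> powr p \<partial>lborel)"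
      by (subst nn_integral_eq_integral[symmetric])
        (auto intro!: nn_integral_cong simp: indicator_def)
    then show ?thesis using True k[of y] by (simp add: B_def ennreal_leI)
  qed simp
  \<comment> \<open>Integrating the hypothesis over y in B costs a factor |B|; the bound for fixed t
    returns the same factor, and it cancels at the end.\<close>
  have "ennreal k * emeasure lborel B = (\<integral>\<^sup>+y. ennreal k * indicator B y \<partial>lborel)"
    by (simp add: nn_integral_cmult)
  also have "\<dots> \<le> (\<integral>\<^sup>+y. \<integral>\<^sup>+x. ennreal (\<bar>v x - v y\<bar> powr p) * indicator B x * indicator B y \<partial>lborel \<partial>lborel)"
    by (intro nn_integral_mono kB)
  also have "\<dots> \<le> (\<integral>\<^sup>+y. \<integral>\<^sup>+x. \<integral>\<^sup>+t. ennreal ((2 * R) powr p) * (ennreal (norm (V (y + t *\<^sub>R (x - y))) powr p)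
     * indicator B x * indicator B y * indicator {0..1} t) \<partial>lborel \<partial>lborel \<partial>lborel)"
  proof (intro nn_integral_mono)
    fix x y
    show "ennreal (\<bar>v x - v y\<bar> powr p) * indicator B x * indicator B y
      \<le> (\<integral>\<^sup>+t. ennreal ((2 * R) powr p) * (ennreal (norm (V (y + t *\<^sub>R (x - y))) powr p)
     * indicator B x * indicator B y * indicator {0..1} t) \<partial>lborel)"
    proof (cases "x \<in> B \<and> y \<in> B")
      case True
      have "dist x y \<le> 2 * R"
        using True norm_triangle_ineq4[of x y] by (auto simp: B_def dist_norm)
      then have "dist x y powr p \<le> (2 * R) powr p" using p by (intro powr_mono2) auto
      have "ennreal (\<bar>v x - v y\<bar> powr p) \<le> (\<integral>\<^sup>+t. ennreal (dist x y powr p * norm (V (y + t *\<^sub>R (x - y))) powr p) * indicator {0..1} t \<partial>lborel)"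
        by (rule segment_average_bound[OF p deriv cont])
      also have "\<dots> \<le> (\<integral>\<^sup>+t. ennreal ((2 * R) powr p * norm (V (y + t *\<^sub>R (x - y))) powr p) * indicator {0..1} t \<partial>lborel)"
        using \<open>dist x y powr p \<le> _\<close>
        by (intro nn_integral_mono mult_right_mono ennreal_leI) auto
      finally show ?thesis using True by (simp add: ennreal_mult mult.assoc)
    qed auto
  qed
  also have "\<dots> = ennreal ((2 * R) powr p) * (\<integral>\<^sup>+y. \<integral>\<^sup>+x. \<integral>\<^sup>+t. ennreal (norm (V (y + t *\<^sub>R (x - y))) powr p)
     * indicator B x * indicator B y * indicator {0..1} t \<partial>lborel \<partial>lborel \<partial>lborel)"
    by (simp add: nn_integral_cmult)
  \<comment> \<open>With t outermost, the convex combination bound applies for each fixed t.\<close>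
  also have "(\<integral>\<^sup>+y. \<integral>\<^sup>+x. \<integral>\<^sup>+t. ennreal (norm (V (y + t *\<^sub>R (x - y))) powr p)
     * indicator B x * indicator B y * indicator {0..1} t \<partial>lborel \<partial>lborel \<partial>lborel)
     = (\<integral>\<^sup>+t. \<integral>\<^sup>+y. \<integral>\<^sup>+x. ennreal (norm (V (y + t *\<^sub>R (x - y))) powr p)
     * indicator B x * indicator B y * indicator {0..1} t \<partial>lborel \<partial>lborel \<partial>lborel)"
  proof -
    have "(\<integral>\<^sup>+y. \<integral>\<^sup>+x. \<integral>\<^sup>+t. ennreal (norm (V (y + t *\<^sub>R (x - y))) powr p)
       * indicator B x * indicator B y * indicator {0..1} t \<partial>lborel \<partial>lborel \<partial>lborel)
     = (\<integral>\<^sup>+y. \<integral>\<^sup>+t. \<integral>\<^sup>+x. ennreal (norm (V (y + t *\<^sub>R (x - y))) powr p)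
       * indicator B x * indicator B y * indicator {0..1} t \<partial>lborel \<partial>lborel \<partial>lborel)"
      by (intro nn_integral_cong lborel_pair.Fubini') measurable
    also have "\<dots> = (\<integral>\<^sup>+t. \<integral>\<^sup>+y. \<integral>\<^sup>+x. ennreal (norm (V (y + t *\<^sub>R (x - y))) powr p)
       * indicator B x * indicator B y * indicator {0..1} t \<partial>lborel \<partial>lborel \<partial>lborel)"
      by (rule lborel_pair.Fubini') measurable
    finally show ?thesis .
  qed
  also have "\<dots> \<le> (\<integral>\<^sup>+t. (2 ^ n * ennreal A * emeasure lborel B) * indicator {0..1::real} t \<partial>lborel)"
  proof (rule nn_integral_mono)
    fix t :: real
    show "(\<integral>\<^sup>+y. \<integral>\<^sup>+x. ennreal (norm (V (y + t *\<^sub>R (x - y))) powr p)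
     * indicator B x * indicator B y * indicator {0..1} t \<partial>lborel \<partial>lborel) \<le> (2 ^ n * ennreal A * emeasure lborel B) * indicator {0..1} t"
      using nn_integral_convex_combination_le[of "\<lambda>x. ennreal (norm (V x) powr p)" B t]
      by (cases "t \<in> {0..1}") (auto simp: A n_def convB)
  qed
  also have "\<dots> = 2 ^ n * ennreal A * emeasure lborel B"
    by (simp add: nn_integral_cmult)
  finally have "ennreal k * emeasure lborel B \<le> ennreal ((2 * R) powr p) * (2 ^ n * ennreal A * emeasure lborel B)"
    by (simp add: mult_left_mono)
  then have "emeasure lborel B * ennreal k \<le> emeasure lborel B * ennreal (2 ^ n * (2 * R) powr p * A)"
    using A_nonneg by (simp add: ennreal_mult mult_ac ennreal_power flip: ennreal_numeral)
  then have "ennreal k \<le> ennreal (2 ^ n * (2 * R) powr p * A)"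
    using B by (subst (asm) ennreal_mult_le_mult_iff) auto
  \<comment> \<open>A negative k, which \<open>ennreal\<close> sends to 0, is covered as well
    because the right-hand side is nonnegative.\<close>
  then have "k \<le> 2 ^ n * (2 * R) powr p * A"
    using A_nonneg by (subst (asm) ennreal_le_iff) auto
  then show ?thesis by (simp add: n_def A_def B_def)
qed

subsection \<open>Test functions on the punctured space\<close>

text \<open>The values of the derivative on the coordinate axes are the entries of a vector
  representing it; uniqueness of derivatives identifies that vector with the definite description in
  \<open>gradient\<close>.\<close>

lemma gradient_has_derivative:
  fixes u :: "real^'n \<Rightarrow> real"
  assumes "u differentiable (at x)"
  shows "(u has_derivative (\<lambda>h. gradient u x \<bullet> h)) (at x)"
    and "gradient u x $ i = partial_derivative i u x"
proof -
  define L where "L = frechet_derivative u (at x)"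
  define D where "D = (\<chi> i. L (axis i 1))"
  have L: "(u has_derivative L) (at x)"
    using assms unfolding L_def by (simp flip: frechet_derivative_works)
  have "L h = D \<bullet> h" for h
  proof -
    have "L h = L (\<Sum>i\<in>UNIV. (h $ i) *\<^sub>R axis i 1)"
      by (simp add: basis_expansion[where 'a=real, unfolded scalar_mult_eq_scaleR])
    also have "\<dots> = (\<Sum>i\<in>UNIV. h $ i * L (axis i 1))"
      using has_derivative_linear[OF L] by (simp add: linear_sum linear_cmul)
    finally show ?thesis by (simp add: D_def inner_vec_def mult.commute)
  qed
  then have "L = (\<lambda>h. D \<bullet> h)" by (rule ext)
  then have D: "(u has_derivative (\<lambda>h. D \<bullet> h)) (at x)" using L by (simp only:)
  have "gradient u x = D"
    unfolding gradient_def gderiv_def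
  proof (rule the_equality)
    show "(u has_derivative (\<lambda>h. h \<bullet> D)) (at x)" using D by (simp add: inner_commute)
    fix D' assume "(u has_derivative (\<lambda>h. h \<bullet> D')) (at x)"
    then have "(\<lambda>h. h \<bullet> D') = (\<lambda>h. D \<bullet> h)" using D by (rule has_derivative_unique)
    then have "h \<bullet> D' = h \<bullet> D" for h by (auto simp: inner_commute dest: fun_cong[of _ _ h])
    then show "D' = D" using vector_eq_ldot by blast
  qed
  then show "(u has_derivative (\<lambda>h. gradient u x \<bullet> h)) (at x)"
    and "gradient u x $ i = partial_derivative i u x"
    using D by (simp_all add: D_def L_def partial_derivative_def)
qed

lemma smooth_gradient:
  fixes u :: "real^'n \<Rightarrow> real"
  assumes "smooth u"
  shows "(u has_derivative (\<lambda>h. gradient u x \<bullet> h)) (at x)"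
    and "continuous_on UNIV (gradient u)"
proof -
  have "C_k (Suc 0) u" using assms by (simp add: smooth_def)
  then have diff: "u differentiable (at x)" and cont: "continuous_on UNIV (partial_derivative i u)" for i x
    by (auto simp: differentiable_on_def)
  show "(u has_derivative (\<lambda>h. gradient u x \<bullet> h)) (at x)"
    by (rule gradient_has_derivative[OF diff])
  have "gradient u = (\<lambda>x. \<chi> i. partial_derivative i u x)"
    by (auto simp: vec_eq_iff gradient_has_derivative(2)[OF diff])
  then show "continuous_on UNIV (gradient u)"
    using cont by (auto intro!: continuous_on_vec_lambda)
qed

text \<open>The support is compact and misses the origin, so it lies in an annulus; its complement
  is open, so the gradient vanishes there as well.\<close>

lemma test_functions_punctured_annulus:
  fixes u :: "real^'n \<Rightarrow> real"
  assumes "u \<in> test_functions_punctured"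
  obtains \<rho> \<sigma> where "0 < \<rho>"
    and "\<And>x. norm x < \<rho> \<or> \<sigma> < norm x \<Longrightarrow> u x = 0"
    and "\<And>x. norm x < \<rho> \<or> \<sigma> < norm x \<Longrightarrow> gradient u x = 0"
proof -
  define K where "K = closure {x. u x \<noteq> 0}"
  have "smooth u" "compact K" "0 \<notin> K"
    using assms by (auto simp: test_functions_punctured_def K_def)
  then have "open (- K)" by (simp add: compact_imp_closed open_Compl)
  have u0: "u x = 0" if "x \<notin> K" for x
    using that closure_subset[of "{x. u x \<noteq> 0}"] by (auto simp: K_def)
  have Du0: "gradient u x = 0" if "x \<notin> K" for x
  proof -
    have "((\<lambda>_. 0) has_derivative (\<lambda>h. gradient u x \<bullet> h)) (at x)"
      using smooth_gradient(1)[OF \<open>smooth u\<close>, of x] \<open>open (- K)\<close>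
      by (rule has_derivative_transform_within_open) (use that u0 in auto)
    then have "(\<lambda>h. gradient u x \<bullet> h) = (\<lambda>_. 0)"
      by (rule has_derivative_unique) simp
    then have "gradient u x \<bullet> gradient u x = 0" by metis
    then show ?thesis by simp
  qed
  obtain \<rho> where \<rho>: "0 < \<rho>" "ball 0 \<rho> \<subseteq> - K"
    using \<open>open (- K)\<close> \<open>0 \<notin> K\<close> by (auto simp: open_contains_ball)
  obtain \<sigma> where \<sigma>: "\<And>x. x \<in> K \<Longrightarrow> norm x \<le> \<sigma>"
    using compact_imp_bounded[OF \<open>compact K\<close>] by (auto simp: bounded_iff)
  have "x \<notin> K" if "norm x < \<rho> \<or> \<sigma> < norm x" for x
    using that \<rho>(2) \<sigma>[of x] by fastforce
  note outside = this
  show ?thesis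
    by (rule that[of \<rho> \<sigma>]) (rule \<rho>(1), erule u0[OF outside], erule Du0[OF outside])
qed

lemma continuous_on_sgn_powr:
  fixes f :: "'a::topological_space \<Rightarrow> real"
  assumes f: "continuous_on S f" and q: "0 < q"
  shows "continuous_on S (\<lambda>x. sgn (f x) * \<bar>f x\<bar> powr q)"
proof -
  \<comment> \<open>\<open>sgn\<close> jumps at 0, so the signed power is split into its positive
    and negative parts, each continuous because q > 0.\<close>
  have "sgn s * \<bar>s\<bar> powr q = max s 0 powr q - max (- s) 0 powr q" for s :: real
    by (simp add: sgn_if max_def)
  then have "(\<lambda>x. sgn (f x) * \<bar>f x\<bar> powr q) = (\<lambda>x. max (f x) 0 powr q - max (- f x) 0 powr q)"
    by blast
  moreover have "continuous_on S (\<lambda>x. max (f x) 0 powr q - max (- f x) 0 powr q)"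
    using q by (intro continuous_on_diff continuous_on_powr' continuous_on_max continuous_on_minus
        continuous_on_const f) auto
  ultimately show ?thesis by (simp only:)
qed

text \<open>f - g is continuous on a compact annulus and zero elsewhere. This serves for weighted
  powers of u - c U, which is - c U outside the annulus carrying u.\<close>

lemma integrable_eq_off_annulus:
  fixes f g :: "'a::euclidean_space \<Rightarrow> real"
  assumes \<rho>: "0 < \<rho>"
    and f: "continuous_on (- {0}) f" and g: "continuous_on (- {0}) g" "integrable lborel g"
    and eq: "\<And>x. norm x < \<rho> \<or> \<sigma> < norm x \<Longrightarrow> f x = g x"
  shows "integrable lborel f"
proof -
  define S where "S = cball (0::'a) \<sigma> - ball 0 \<rho>"
  have "integrable lborel (\<lambda>x. indicator S x *\<^sub>R (f x - g x))"
  proof (rule borel_integrable_compact)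
    show "compact S" unfolding S_def by (intro compact_diff) auto
    have "S \<subseteq> - {0}" using \<rho> by (auto simp: S_def)
    then show "continuous_on S (\<lambda>x. f x - g x)"
      using f g by (auto intro!: continuous_intros intro: continuous_on_subset)
  qed
  moreover have "(\<lambda>x. indicator S x *\<^sub>R (f x - g x)) = (\<lambda>x. f x - g x)"
  proof
    fix x
    have "norm x < \<rho> \<or> \<sigma> < norm x" if "x \<notin> S"
      using that by (auto simp: S_def)
    then have "f x = g x" if "x \<notin> S"
      using that eq by blast
    then show "indicator S x *\<^sub>R (f x - g x) = f x - g x"
      by (cases "x \<in> S") simp_all
  qed
  ultimately have "integrable lborel (\<lambda>x. (f x - g x) + g x)"
    using g(2) by (intro Bochner_Integration.integrable_add) simp
  then show ?thesis by simp
qed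

text \<open>The constant is the maximum of y^q exp(-\<eta> y), attained at y = q / \<eta>; it comes
  from ln z <= z - 1 with z = \<eta> y / q.\<close>

lemma powr_exp_minus_bounded:
  fixes q \<eta> :: real
  assumes "0 < q" "0 < \<eta>"
  obtains C where "0 < C" "\<And>y. 0 < y \<Longrightarrow> y powr q * exp (- \<eta> * y) \<le> C"
proof (rule that[of "exp (q * (- 1 - ln (\<eta> / q)))"])
  fix y :: real assume y: "0 < y"
  have "ln ((\<eta> / q) * y) \<le> (\<eta> / q) * y - 1"
    using assms y by (intro ln_le_minus_one) auto
  then have "q * ln y \<le> q * ((\<eta> / q) * y - 1 - ln (\<eta> / q))"
    using assms y by (intro mult_left_mono) (simp_all add: ln_mult ln_div)
  then have "q * ln y - \<eta> * y \<le> q * (- 1 - ln (\<eta> / q))"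
    using assms by (simp add: algebra_simps)
  then show "y powr q * exp (- \<eta> * y) \<le> exp (q * (- 1 - ln (\<eta> / q)))"
    using y by (simp add: powr_def flip: exp_add)
qed simp

subsection \<open>The Lyapunov density\<close>

text \<open>With \<open>h = (\<tau> - 1) / (\<tau> + 1)\<close> and \<open>\<tau> = r\<^sup>\<kappa>\<close>, this is what remains of minus the divergence of
  \<open>h |f|\<^sup>p r\<^bsup>- \<gamma>\<^esup> x\<close>, relative to \<open>|f|\<^sup>p r\<^bsup>- \<gamma>\<^esup>\<close>, once the term containing \<open>W\<close> has been split by
  Young's inequality; here \<open>f = u - c U\<close> and \<open>m = N - \<gamma>\<close>. The values \<open>h(0) = -1\<close> and \<open>h(\<infinity>) = 1\<close> make it positive
  near the origin and near infinity.\<close>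
definition lyapunov_density :: "real \<Rightarrow> real \<Rightarrow> real \<Rightarrow> real \<Rightarrow> real" where
  "lyapunov_density p m \<kappa> \<tau> =
     p * \<tau> * ((\<tau> - 1) / (\<tau> + 1)) - (p - 1) * \<tau> * \<bar>(\<tau> - 1) / (\<tau> + 1)\<bar>
     - m * ((\<tau> - 1) / (\<tau> + 1)) - 2 * \<kappa> * \<tau> / (\<tau> + 1)\<^sup>2"

text \<open>For \<tau> <= 1 the sign of h joins the first two terms to (2 p - 1) \<tau> h, and -h >=
  1 - 2 \<tau> leaves m up to a multiple of \<tau>. For \<tau> >= 1 they join to \<tau> h, which is
  at least \<tau> - 2. L is a crude common constant.\<close>

lemma lyapunov_density_bounds:
  fixes p m \<kappa> \<tau> :: real
  assumes p: "1 \<le> p" and m: "0 < m" and \<kappa>: "0 < \<kappa>" and \<tau>: "0 \<le> \<tau>"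
  defines "L \<equiv> 2 * m + 2 * p + 2 * \<kappa> + 2"
  shows "\<tau> \<le> 1 \<Longrightarrow> m - L * \<tau> \<le> lyapunov_density p m \<kappa> \<tau>"
    and "1 \<le> \<tau> \<Longrightarrow> \<tau> - L \<le> lyapunov_density p m \<kappa> \<tau>"
proof -
  define h where "h = (\<tau> - 1) / (\<tau> + 1)"
  define w where "w = \<tau> / (\<tau> + 1)\<^sup>2"
  have Q: "lyapunov_density p m \<kappa> \<tau> = p * \<tau> * h - (p - 1) * \<tau> * \<bar>h\<bar> - m * h - 2 * \<kappa> * w"
    by (simp add: lyapunov_density_def h_def w_def)
  have "1 \<le> (\<tau> + 1)\<^sup>2" using \<tau> by (simp add: power2_eq_square algebra_simps)
  then have w: "w \<le> \<tau>" unfolding w_def using \<tau> by (simp add: divide_le_eq mult_le_cancel_left1)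
  have "\<tau> \<le> (\<tau> + 1)\<^sup>2" using \<tau> by (simp add: power2_eq_square algebra_simps)
  then have w1: "w \<le> 1" unfolding w_def using \<tau> by (simp add: divide_le_eq)
  have h1: "- 1 \<le> h" "h \<le> 1" using \<tau> by (auto simp: h_def field_simps)
  have kw: "2 * \<kappa> * w \<le> 2 * \<kappa> * \<tau>" "2 * \<kappa> * w \<le> 2 * \<kappa> * 1"
    using w w1 \<kappa> by (intro mult_left_mono; simp)+
  show "m - L * \<tau> \<le> lyapunov_density p m \<kappa> \<tau>" if "\<tau> \<le> 1"
  proof -
    have "h \<le> 0" using that \<tau> by (auto simp: h_def divide_le_0_iff)
    have "(1 - 2 * \<tau>) * (\<tau> + 1) \<le> 1 - \<tau>"
      by (simp add: algebra_simps)
    then have "1 - 2 * \<tau> \<le> - h" using \<tau> by (simp add: h_def field_simps)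
    then have "m * (1 - 2 * \<tau>) \<le> m * (- h)" using m by (intro mult_left_mono) auto
    moreover have "(2 * p - 1) * \<tau> * (- 1) \<le> (2 * p - 1) * \<tau> * h"
      using h1 p \<tau> by (intro mult_left_mono) auto
    moreover have "lyapunov_density p m \<kappa> \<tau> = (2 * p - 1) * \<tau> * h - m * h - 2 * \<kappa> * w"
      using \<open>h \<le> 0\<close> by (simp add: Q algebra_simps)
    ultimately have "m * (1 - 2 * \<tau>) - (2 * p - 1) * \<tau> - 2 * \<kappa> * \<tau> \<le> lyapunov_density p m \<kappa> \<tau>"
      using kw by linarith
    moreover have "m - L * \<tau> \<le> m * (1 - 2 * \<tau>) - (2 * p - 1) * \<tau> - 2 * \<kappa> * \<tau>"
      using \<tau> by (simp add: L_def algebra_simps)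
    ultimately show ?thesis by linarith
  qed
  show "\<tau> - L \<le> lyapunov_density p m \<kappa> \<tau>" if "1 \<le> \<tau>"
  proof -
    have "0 \<le> h" using that \<tau> by (auto simp: h_def)
    then have "lyapunov_density p m \<kappa> \<tau> = \<tau> * h - m * h - 2 * \<kappa> * w"
      by (simp add: Q algebra_simps)
    moreover have "\<tau> - 2 \<le> \<tau> * h"
      using \<tau> by (simp add: h_def field_simps)
    moreover have "m * h \<le> m" using h1 m by simp
    moreover have "2 + m + 2 * \<kappa> \<le> L" using m p by (simp add: L_def)
    ultimately show ?thesis using kw by linarith
  qed
qed

text \<open>Up to t the density is at least m / 2 because L t = m / 2, and above T = L + m it
  exceeds m. In between it is at least -L, which M t^s = m / 2 + L repairs. The correction is a
  power of \<tau> and not a constant so that with s = \<gamma> / \<kappa> it cancels the weight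
  r^(-\<gamma>).\<close>

lemma lyapunov_density_ge:
  fixes p m \<kappa> s :: real
  assumes p: "1 \<le> p" and m: "0 < m" and \<kappa>: "0 < \<kappa>" and s: "0 \<le> s"
  obtains M T where "0 < M" "0 < T"
    "\<And>\<tau>. 0 \<le> \<tau> \<Longrightarrow> m / 2 \<le> lyapunov_density p m \<kappa> \<tau> + (if \<tau> \<le> T then M * \<tau> powr s else 0)"
proof -
  define L where "L = 2 * m + 2 * p + 2 * \<kappa> + 2"
  define t where "t = m / (2 * L)"
  have L: "0 < L" "m < L" using p m \<kappa> by (auto simp: L_def)
  have t: "0 < t" "t \<le> 1" using L m by (auto simp: t_def)
  note bounds = lyapunov_density_bounds[OF p m \<kappa>, folded L_def]
  define M where "M = (m / 2 + L) * t powr - s"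
  show ?thesis
  proof (rule that[of M "L + m"])
    show "0 < M" "0 < L + m" using L m t by (auto simp: M_def)
    fix \<tau> :: real assume \<tau>: "0 \<le> \<tau>"
    have M0: "0 \<le> M * \<tau> powr s" using L m by (simp add: M_def)
    consider "\<tau> \<le> t" | "L + m < \<tau>" | "t < \<tau>" "\<tau> \<le> L + m" by linarith
    then show "m / 2 \<le> lyapunov_density p m \<kappa> \<tau> + (if \<tau> \<le> L + m then M * \<tau> powr s else 0)"
    proof cases
      case 1
      have "L * \<tau> \<le> L * t" using 1 L by (intro mult_left_mono) auto
      also have "\<dots> = m / 2" using L by (simp add: t_def)
      finally show ?thesis using bounds(1)[OF \<tau>] 1 t M0 by auto
    next
      case 2
      then have "1 \<le> \<tau>" using m p \<kappa> by (simp add: L_def)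
      then show ?thesis using bounds(2)[OF \<tau>] 2 m by auto
    next
      case 3
      have "- L \<le> lyapunov_density p m \<kappa> \<tau>"
      proof (cases "\<tau> \<le> 1")
        case True
        then have "L * \<tau> \<le> L * 1" using L by (intro mult_left_mono) auto
        then show ?thesis using bounds(1)[OF \<tau> True] m by simp
      qed (use bounds(2)[OF \<tau>] in auto)
      moreover have "1 \<le> t powr - s * \<tau> powr s"
        using 3 t s powr_mono2[of s t \<tau>] by (simp add: powr_minus field_simps)
      then have "(m / 2 + L) * 1 \<le> (m / 2 + L) * (t powr - s * \<tau> powr s)"
        using L m by (intro mult_left_mono) auto
      then have "m / 2 + L \<le> M * \<tau> powr s"
        by (simp add: M_def mult.assoc)
      ultimately show ?thesis using 3 by simp
    qed
  qed
qed

subsection \<open>Deficit, energy and distance to the extremals\<close>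

lemma DERIV_norm_powr_ray:
  fixes x :: "'a::real_normed_vector"
  assumes "x \<noteq> 0"
  shows "((\<lambda>s. norm (s *\<^sub>R x) powr q) has_real_derivative q * norm x powr q) (at 1)"
proof (rule has_field_derivative_transform_within_open[where S = "{0<..}"])
  show "((\<lambda>s. (s * norm x) powr q) has_real_derivative q * norm x powr q) (at 1)"
    using assms by (auto intro!: derivative_eq_intros simp: powr_diff)
qed (auto simp: abs_mult)

text \<open>\<gamma> below the dimension makes r^(-\<gamma>) locally integrable, \<kappa> > 0 makes
  U decay at infinity, and vanishing off an annulus keeps the integrals of u and its gradient away
  from the singular weights.\<close>

locale annular_function =
  fixes u :: "'a::euclidean_space \<Rightarrow> real" and Du :: "'a \<Rightarrow> 'a" and \<rho> \<sigma> p a b \<gamma> \<kappa> :: real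
  assumes deriv: "\<And>x. (u has_derivative (\<lambda>h. Du x \<bullet> h)) (at x)"
    and cont_Du: "continuous_on UNIV Du"
    and \<rho>: "0 < \<rho>"
    and u_0: "\<And>x. norm x < \<rho> \<or> \<sigma> < norm x \<Longrightarrow> u x = 0"
    and Du_0: "\<And>x. norm x < \<rho> \<or> \<sigma> < norm x \<Longrightarrow> Du x = 0"
    and p: "2 \<le> p" and b: "0 \<le> b"
    and \<gamma>_def: "\<gamma> = (p - 1) * a + b + 1" and \<kappa>_def: "\<kappa> = b - a + 1"
    and \<gamma>: "0 \<le> \<gamma>" "\<gamma> < DIM('a)" and \<kappa>: "0 < \<kappa>"
begin

definition W :: "'a \<Rightarrow> 'a" where
  "W x = Du x + (u x * norm x powr (\<kappa> - 2)) *\<^sub>R x"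

lemma cont_u: "continuous_on S u"
  using deriv by (auto intro!: continuous_at_imp_continuous_on has_derivative_continuous)

lemma cont_Du': "continuous_on S Du"
  using cont_Du by (rule continuous_on_subset) auto

lemma cont_norm_powr: "continuous_on (- {0}) (\<lambda>x::'a. norm x powr q)"
  by (auto intro!: continuous_intros)

lemma cont_abs_powr: "continuous_on S f \<Longrightarrow> 0 < q \<Longrightarrow> continuous_on S (\<lambda>x::'a. \<bar>f x::real\<bar> powr q)"
  by (auto intro!: continuous_intros continuous_on_powr')

lemma cont_norm_powr_comp:
  "continuous_on S f \<Longrightarrow> 0 < q \<Longrightarrow> continuous_on S (\<lambda>x::'a. norm (f x::'a) powr q)"
  by (auto intro!: continuous_intros continuous_on_powr')

lemma cont_W: "continuous_on (- {0}) W"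
  unfolding W_def by (intro continuous_intros cont_u cont_Du' cont_norm_powr) auto

lemma W_0: "norm x < \<rho> \<or> \<sigma> < norm x \<Longrightarrow> W x = 0"
  by (simp add: W_def u_0 Du_0)

lemmas cont = continuous_on_mult continuous_on_add continuous_on_diff continuous_on_const
  continuous_on_inner continuous_on_id continuous_on_norm cont_u cont_Du' cont_norm_powr cont_abs_powr cont_norm_powr_comp
  cont_W continuous_on_sgn_powr

lemma integrable_annulus:
  "continuous_on (- {0}) f \<Longrightarrow> (\<And>x. norm x < \<rho> \<or> \<sigma> < norm x \<Longrightarrow> f x = 0) \<Longrightarrow> integrable lborel f"
  for f :: "'a \<Rightarrow> real"
  by (rule integrable_eq_off_annulus[OF \<rho>, where g = "\<lambda>_. 0"]) auto

lemma DERIV_u_ray: "((\<lambda>s. u (s *\<^sub>R x)) has_real_derivative Du x \<bullet> x) (at 1)"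
proof -
  have "((\<lambda>s::real. s *\<^sub>R x) has_derivative (\<lambda>h. h *\<^sub>R x)) (at 1)"
    by (auto intro!: derivative_eq_intros)
  moreover have "(u has_derivative (\<lambda>h. Du x \<bullet> h)) (at (1 *\<^sub>R x))"
    using deriv[of x] by simp
  ultimately have "((\<lambda>s. u (s *\<^sub>R x)) has_derivative (\<lambda>h. Du x \<bullet> (h *\<^sub>R x))) (at 1)"
    by (rule has_derivative_compose)
  then show ?thesis
    by (simp add: has_field_derivative_def mult_commute_abs)
qed

section \<open>The energy and the deficit\<close>

definition energy :: real where
  "energy = (\<integral>x. norm (W x) powr p * norm x powr - (p * b) \<partial>lborel)"

lemma integrable_energy: "integrable lborel (\<lambda>x. norm (W x) powr p * norm x powr - (p * b))"
  using p by (intro integrable_annulus) (auto intro!: cont simp: W_0)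

lemma convexity_gap_pointwise:
  assumes x: "x \<noteq> 0"
  shows "2 powr (1 - p) * (norm (W x) powr p * norm x powr - (p * b))
    \<le> norm (Du x) powr p * norm x powr - (p * b) + (p - 1) * (\<bar>u x\<bar> powr p * norm x powr - (p * a))
      + p * (sgn (u x) * \<bar>u x\<bar> powr (p - 1)) * (Du x \<bullet> x) * norm x powr - \<gamma>"
proof -
  define r where "r = norm x"
  have r: "0 < r" using x by (simp add: r_def)
  define e where "e = (1 / r) *\<^sub>R x"
  define A where "A = r powr - b *\<^sub>R Du x"
  define \<beta> where "\<beta> = - (u x * r powr - a)"
  have e: "norm e = 1" using r by (simp add: e_def r_def)
  have pp: "(r powr - s) powr t = r powr - (t * s)" for s t
    by (simp add: powr_powr mult.commute)
  \<comment> \<open>The value of \<kappa> gives -b + \<kappa> - 2 = -a - 1, so A - \<beta> e is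
    r^(-b) W.\<close>
  have "r powr (- b) * r powr (\<kappa> - 2) = r powr - a * (1 / r)"
    using r by (simp add: \<kappa>_def powr_diff powr_add powr_minus field_simps powr_numeral power2_eq_square)
  then have "A - \<beta> *\<^sub>R e = r powr - b *\<^sub>R W x"
    by (simp add: A_def \<beta>_def e_def W_def scaleR_add_right mult.assoc mult.left_commute flip: r_def)
  then have 1: "norm (A - \<beta> *\<^sub>R e) powr p = norm (W x) powr p * r powr - (p * b)"
    by (simp add: powr_mult pp mult.commute)
  have 2: "norm A powr p = norm (Du x) powr p * r powr - (p * b)"
    by (simp add: A_def powr_mult pp mult.commute)
  have 3: "\<bar>\<beta>\<bar> powr p = \<bar>u x\<bar> powr p * r powr - (p * a)"
    by (simp add: \<beta>_def abs_mult powr_mult pp)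
  \<comment> \<open>The exponent \<gamma> collects (p - 1) a from |\<beta>|^(p-1), b from A and 1
    from the normalisation of e.\<close>
  have "r powr - \<gamma> = r powr - ((p - 1) * a) * r powr - b * (1 / r)"
    using r by (simp add: \<gamma>_def powr_diff powr_add powr_minus field_simps)
  moreover have "sgn \<beta> * \<bar>\<beta>\<bar> powr (p - 1) = - (sgn (u x) * \<bar>u x\<bar> powr (p - 1)) * r powr - ((p - 1) * a)"
    using r by (simp add: \<beta>_def abs_mult powr_mult pp sgn_mult sgn_minus)
  moreover have "e \<bullet> A = r powr - b * (1 / r) * (Du x \<bullet> x)"
    by (simp add: e_def A_def inner_commute)
  ultimately have 4: "p * (sgn \<beta> * \<bar>\<beta>\<bar> powr (p - 1)) * (e \<bullet> A)
    = - (p * (sgn (u x) * \<bar>u x\<bar> powr (p - 1)) * (Du x \<bullet> x) * r powr - \<gamma>)"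
    by simp
  show ?thesis
    using powr_norm_convexity_gap[OF p e, of A \<beta>] unfolding 1 2 3 4 r_def by simp
qed

lemma energy_le_deficit:
  "2 powr (1 - p) * energy
    \<le> (\<integral>x. norm (Du x) powr p / norm x powr (p * b) \<partial>lborel)
      + (p - 1) * (\<integral>x. \<bar>u x\<bar> powr p / norm x powr (p * a) \<partial>lborel)
      - (real DIM('a) - \<gamma>) * (\<integral>x. \<bar>u x\<bar> powr p / norm x powr \<gamma> \<partial>lborel)"
proof -
  define F where "F x = \<bar>u x\<bar> powr p * norm x powr - \<gamma>" for x
  define X where "X x = p * (sgn (u x) * \<bar>u x\<bar> powr (p - 1)) * (Du x \<bullet> x) * norm x powr - \<gamma>" for x
  define A1 where "A1 x = norm (Du x) powr p * norm x powr - (p * b)" for x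
  define A2 where "A2 x = \<bar>u x\<bar> powr p * norm x powr - (p * a)" for x
  have contF: "continuous_on (- {0}) F" and contX: "continuous_on (- {0}) X"
    unfolding F_def X_def using p by (intro cont; simp)+
  have F: "integrable lborel F" and X: "integrable lborel X"
    using contF contX p by (auto intro!: integrable_annulus simp: F_def X_def u_0)
  have A1: "integrable lborel A1" and A2: "integrable lborel A2"
    unfolding A1_def A2_def using p
    by (auto intro!: integrable_annulus cont simp: u_0 Du_0)
  \<comment> \<open>The dilation derivative of F is X - \<gamma> F, so the integral of X is -(n -
    \<gamma>) times that of F, n the dimension: the subtracted term of the deficit becomes the cross
    term of the convexity gap.\<close>
  have "(\<integral>x. real DIM('a) * F x + (X x - \<gamma> * F x) \<partial>lborel) = 0"
  proof (rule integral_dilation_derivative_eq_0)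
    show "integrable lborel (\<lambda>x. X x - \<gamma> * F x)" using F X by simp
    show "continuous_on (- {0}) (\<lambda>x. X x - \<gamma> * F x)"
      by (intro continuous_intros contF contX)
    fix x :: 'a assume "x \<noteq> 0"
    have "((\<lambda>s. \<bar>u (s *\<^sub>R x)\<bar> powr p) has_real_derivative
        p * (sgn (u x) * \<bar>u x\<bar> powr (p - 1)) * (Du x \<bullet> x)) (at 1)"
      using DERIV_chain'[OF DERIV_u_ray[of x] DERIV_abs_powr[of p "u (1 *\<^sub>R x)"]] p by simp
    from DERIV_mult[OF this DERIV_norm_powr_ray[OF \<open>x \<noteq> 0\<close>, of "- \<gamma>"]]
    show "((\<lambda>s. F (s *\<^sub>R x)) has_real_derivative X x - \<gamma> * F x) (at 1)"
      by (simp add: F_def X_def algebra_simps)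
  qed (fact F)
  then have "(\<integral>x. X x \<partial>lborel) = - (real DIM('a) - \<gamma>) * (\<integral>x. F x \<partial>lborel)"
    using F X by (simp add: algebra_simps)
  then have "(\<integral>x. A1 x \<partial>lborel) + (p - 1) * (\<integral>x. A2 x \<partial>lborel) - (real DIM('a) - \<gamma>) * (\<integral>x. F x \<partial>lborel)
    = (\<integral>x. A1 x + (p - 1) * A2 x + X x \<partial>lborel)"
    using A1 A2 X by (simp add: algebra_simps)
  moreover have "2 powr (1 - p) * energy \<le> (\<integral>x. A1 x + (p - 1) * A2 x + X x \<partial>lborel)"
    unfolding energy_def integral_mult_right_zero[symmetric]
  proof (rule integral_mono)
    fix x :: 'a
    show "2 powr (1 - p) * (norm (W x) powr p * norm x powr - (p * b)) \<le> A1 x + (p - 1) * A2 x + X x"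
      using convexity_gap_pointwise[of x] W_0[of 0] \<rho>
      by (cases "x = 0") (auto simp: A1_def A2_def X_def)
  qed (use A1 A2 X integrable_energy in auto)
  ultimately show ?thesis
    by (simp add: A1_def A2_def F_def powr_minus divide_inverse)
qed

section \<open>The profile \<open>U\<close> and the Lyapunov inequality\<close>

definition U :: "'a \<Rightarrow> real" where
  "U x = exp (- (norm x powr \<kappa>) / \<kappa>)"

lemma U_pos: "0 < U x" by (simp add: U_def)

lemma U_le_1: "U x \<le> 1" using \<kappa> by (simp add: U_def)

lemma cont_U: "continuous_on (- {0}) U"
  unfolding U_def using \<kappa> by (intro continuous_intros) auto

lemma DERIV_U_ray:
  assumes "x \<noteq> 0"
  shows "((\<lambda>s. U (s *\<^sub>R x)) has_real_derivative - U x * norm x powr \<kappa>) (at 1)"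
proof -
  have "((\<lambda>s. - (norm (s *\<^sub>R x) powr \<kappa>) / \<kappa>) has_real_derivative - (\<kappa> * norm x powr \<kappa>) / \<kappa>) (at 1)"
    using DERIV_cdivide[OF DERIV_minus[OF DERIV_norm_powr_ray[OF assms, of \<kappa>]], of \<kappa>] by simp
  from DERIV_chain'[OF this DERIV_exp] show ?thesis
    using \<kappa> by (simp add: U_def mult.commute)
qed

lemma borel_measurable_punctured:
  "continuous_on (- {0}) f \<Longrightarrow> f \<in> borel_measurable borel" for f :: "'a \<Rightarrow> real"
  by (rule borel_measurable_continuous_countable_exceptions[of "{0}"]) auto

text \<open>Near the origin the integrand is at most a multiple of r^(-\<gamma>); at infinity U^p
  beats every power. The factor 1 + r^\<kappa> is there because the Lyapunov density grows linearly
  in \<tau> = r^\<kappa>.\<close>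

lemma integrable_U_weight:
  "integrable lborel (\<lambda>x. (1 + norm x powr \<kappa>) * (U x powr p * norm x powr - \<gamma>))"
proof -
  \<comment> \<open>This q makes (r^\<kappa>)^q = r^\<kappa> r^(n+1), n the dimension, so one bound
    absorbs the factor r^\<kappa> and leaves the integrable tail r^(-n-1).\<close>
  define q where "q = 1 + (real DIM('a) + 1) / \<kappa>"
  have q: "0 < q" "\<kappa> * q = \<kappa> + real DIM('a) + 1" using \<kappa> by (auto simp: q_def field_simps)
  obtain C where C: "0 < C" "\<And>y. 0 < y \<Longrightarrow> y powr q * exp (- (p / \<kappa>) * y) \<le> C"
    using powr_exp_minus_bounded[of q "p / \<kappa>"] q \<kappa> p by auto
  have Up: "U x powr p = exp (- (p / \<kappa>) * norm x powr \<kappa>)" for x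
    by (simp add: U_def powr_def)
  show ?thesis
  proof (rule integrable_norm_powr_bounds[where C = "2 + 2 * C" and s = \<gamma> and s' = "real DIM('a) + 1"])
    show "(\<lambda>x. (1 + norm x powr \<kappa>) * (U x powr p * norm x powr - \<gamma>)) \<in> borel_measurable borel"
      by (intro borel_measurable_punctured cont continuous_on_powr cont_U) (auto simp: U_def)
  next
    fix x :: 'a assume x: "x \<noteq> 0" "norm x \<le> 1"
    have "norm x powr \<kappa> \<le> 1 powr \<kappa>" using x \<kappa> by (intro powr_mono2) auto
    moreover have "U x powr p \<le> 1 powr p" using U_le_1[of x] U_pos[of x] p by (intro powr_mono2) auto
    ultimately have "(1 + norm x powr \<kappa>) * U x powr p \<le> 2 * 1"
      by (intro mult_mono) auto
    then have "(1 + norm x powr \<kappa>) * U x powr p * norm x powr - \<gamma> \<le> (2 + 2 * C) * norm x powr - \<gamma>"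
      using C(1) by (intro mult_right_mono) auto
    then show "\<bar>(1 + norm x powr \<kappa>) * (U x powr p * norm x powr - \<gamma>)\<bar> \<le> (2 + 2 * C) * norm x powr - \<gamma>"
      by (simp add: abs_mult mult.assoc)
  next
    fix x :: 'a assume x: "1 \<le> norm x"
    define r where "r = norm x"
    have r: "1 \<le> r" using x by (simp add: r_def)
    have "1 \<le> r powr \<kappa>" using r \<kappa> by (simp add: ge_one_powr_ge_zero)
    have "r powr - \<gamma> \<le> 1" using r \<gamma>(1) powr_mono[of "- \<gamma>" 0 r] by simp
    have "(r powr \<kappa>) powr q = r powr \<kappa> * r powr (real DIM('a) + 1)"
      using q(2) by (simp add: powr_powr flip: powr_add) (simp add: add.assoc)
    then have "r powr \<kappa> * U x powr p * r powr (real DIM('a) + 1) \<le> C"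
      using C(2)[of "r powr \<kappa>"] r by (simp add: Up mult_ac flip: r_def)
    then have "r powr \<kappa> * U x powr p \<le> C * r powr - (real DIM('a) + 1)"
      unfolding powr_minus divide_inverse[symmetric] using r by (subst pos_le_divide_eq) auto
    moreover have "(1 + r powr \<kappa>) * (U x powr p * r powr - \<gamma>) \<le> (2 * r powr \<kappa>) * (U x powr p * 1)"
      using \<open>1 \<le> r powr \<kappa>\<close> \<open>r powr - \<gamma> \<le> 1\<close> by (intro mult_mono mult_left_mono) auto
    ultimately have "(1 + r powr \<kappa>) * (U x powr p * r powr - \<gamma>) \<le> 2 * (C * r powr - (real DIM('a) + 1))"
      by linarith
    also have "\<dots> \<le> (2 + 2 * C) * r powr - (real DIM('a) + 1)"
      by (simp add: algebra_simps)
    finally show "\<bar>(1 + norm x powr \<kappa>) * (U x powr p * norm x powr - \<gamma>)\<bar> \<le> (2 + 2 * C) * norm x powr - (real DIM('a) + 1)"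
      by (simp add: abs_mult r_def)
  qed (use C(1) \<gamma> in auto)
qed

lemma sgn_powr_mult: "sgn s * \<bar>s\<bar> powr (p - 1) * s = \<bar>s\<bar> powr p" for s :: real
  by (cases "s = 0") (auto simp: powr_diff sgn_if)

text \<open>Since x . grad U = -\<tau> U, the function f = u - c U satisfies x . grad f = W . x -
  \<tau> f with the same W for every c. This is why the bound does not depend on c.\<close>

lemma Lyapunov_inequality:
  fixes c :: real
  defines "P \<equiv> \<lambda>x. \<bar>u x - c * U x\<bar> powr p * norm x powr - \<gamma>"
  shows "integrable lborel P"
    and "integrable lborel (\<lambda>x. lyapunov_density p (real DIM('a) - \<gamma>) \<kappa> (norm x powr \<kappa>) * P x)"
    and "(\<integral>x. lyapunov_density p (real DIM('a) - \<gamma>) \<kappa> (norm x powr \<kappa>) * P x \<partial>lborel) \<le> energy"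
proof -
  define n where "n = real DIM('a)"
  define f where "f x = u x - c * U x" for x
  define \<tau> where "\<tau> x = norm x powr \<kappa>" for x :: 'a
  define h where "h x = (\<tau> x - 1) / (\<tau> x + 1)" for x
  define w where "w x = 2 * \<kappa> * \<tau> x / (\<tau> x + 1)\<^sup>2" for x
  define S where "S x = p * (sgn (f x) * \<bar>f x\<bar> powr (p - 1)) * (W x \<bullet> x) * norm x powr - \<gamma> * h x" for x
  have \<tau>_nonneg: "0 \<le> \<tau> x" for x by (simp add: \<tau>_def)
  then have \<tau>1: "\<tau> x + 1 \<noteq> 0" for x by (smt (verit))
  have h1: "\<bar>h x\<bar> \<le> 1" for x using \<tau>_nonneg[of x] by (auto simp: h_def abs_le_iff field_simps)
  have w1: "0 \<le> w x" "w x \<le> 2 * \<kappa> * (1 + \<tau> x)" for x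
  proof -
    have "1 \<le> (\<tau> x + 1)\<^sup>2" using \<tau>_nonneg[of x] by (simp add: power2_eq_square algebra_simps)
    then have "\<tau> x * 1 \<le> \<tau> x * (\<tau> x + 1)\<^sup>2" using \<tau>_nonneg[of x] by (rule mult_left_mono)
    then have "\<tau> x / (\<tau> x + 1)\<^sup>2 \<le> \<tau> x" using \<tau>1[of x] by (simp add: divide_le_eq)
    then have "\<tau> x / (\<tau> x + 1)\<^sup>2 \<le> 1 + \<tau> x" by simp
    then show "w x \<le> 2 * \<kappa> * (1 + \<tau> x)" 
      using mult_left_mono[of "\<tau> x / (\<tau> x + 1)\<^sup>2" "1 + \<tau> x" "2 * \<kappa>"] \<kappa> by (simp add: w_def)
  qed (use \<tau>_nonneg[of x] \<kappa> in \<open>auto simp: w_def\<close>)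
  have cont_f: "continuous_on (- {0}) f"
    unfolding f_def by (intro cont cont_U)
  have cont_\<tau>: "continuous_on (- {0}) \<tau>" unfolding \<tau>_def by (rule cont_norm_powr)
  have cont_h: "continuous_on (- {0}) h"
    unfolding h_def using \<tau>1 by (intro continuous_on_divide cont cont_\<tau>) auto
  have cont_w: "continuous_on (- {0}) w"
    unfolding w_def using \<tau>1 by (intro continuous_on_divide continuous_on_power cont cont_\<tau>) auto
  have P_eq: "P x = \<bar>f x\<bar> powr p * norm x powr - \<gamma>" for x by (simp add: P_def f_def)
  have P_nonneg: "0 \<le> P x" for x by (simp add: P_def)
  have cont_P: "continuous_on (- {0}) P"
    unfolding P_eq[abs_def] using p by (intro cont cont_f) auto
  have cont_S: "continuous_on (- {0}) S"
    unfolding S_def using p by (intro cont cont_f cont_h) auto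
  \<comment> \<open>Outside the annulus this is |c|^p times the function of
    \<open>integrable_U_weight\<close>. It then dominates P times any multiplier of at most linear
    growth in \<tau>.\<close>
  have int_P1: "integrable lborel (\<lambda>x. (1 + \<tau> x) * P x)"
  proof (rule integrable_eq_off_annulus[OF \<rho>])
    show "continuous_on (- {0}) (\<lambda>x. (1 + \<tau> x) * P x)"
      by (intro cont cont_\<tau> cont_P)
    show "continuous_on (- {0}) (\<lambda>x. \<bar>c\<bar> powr p * ((1 + norm x powr \<kappa>) * (U x powr p * norm x powr - \<gamma>)))"
      by (intro cont continuous_on_powr cont_U) (auto simp: U_def)
    show "integrable lborel (\<lambda>x. \<bar>c\<bar> powr p * ((1 + norm x powr \<kappa>) * (U x powr p * norm x powr - \<gamma>)))"
      by (intro integrable_mult_right integrable_U_weight)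
    show "(1 + \<tau> x) * P x = \<bar>c\<bar> powr p * ((1 + norm x powr \<kappa>) * (U x powr p * norm x powr - \<gamma>))"
      if "norm x < \<rho> \<or> \<sigma> < norm x" for x
      using u_0[OF that] U_pos[of x] by (simp add: P_def \<tau>_def abs_mult powr_mult)
  qed
  have int_P: "integrable lborel (\<lambda>x. \<phi> x * P x)"
    if "continuous_on (- {0}) \<phi>" and bound: "\<And>x. \<bar>\<phi> x\<bar> \<le> k * (1 + \<tau> x)" for \<phi> k
  proof (rule Bochner_Integration.integrable_bound)
    show "integrable lborel (\<lambda>x. k * ((1 + \<tau> x) * P x))" using int_P1 by simp
    show "(\<lambda>x. \<phi> x * P x) \<in> borel_measurable lborel"
      using that cont_P by (auto intro!: borel_measurable_punctured cont)
    show "AE x in lborel. norm (\<phi> x * P x) \<le> norm (k * ((1 + \<tau> x) * P x))"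
    proof (rule AE_I2)
      fix x
      have "\<bar>\<phi> x\<bar> * P x \<le> k * (1 + \<tau> x) * P x"
        using bound[of x] P_nonneg[of x] by (rule mult_right_mono)
      also have "\<dots> \<le> \<bar>k * (1 + \<tau> x) * P x\<bar>" by (rule abs_ge_self)
      finally show "norm (\<phi> x * P x) \<le> norm (k * ((1 + \<tau> x) * P x))"
        using P_nonneg[of x] by (simp add: abs_mult mult.assoc)
    qed
  qed
  have "integrable lborel (\<lambda>x. 1 * P x)"
    using \<tau>_nonneg by (intro int_P[where k = 1]) auto
  then show "integrable lborel P" by simp
  have int_S: "integrable lborel S"
    using cont_S by (rule integrable_annulus) (simp add: S_def W_0)
  have int_hP: "integrable lborel (\<lambda>x. h x * P x)"
    using h1 \<tau>_nonneg by (intro int_P[where k = 1] cont_h) (simp add: order.trans[OF h1])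
  have "\<bar>\<tau> x * h x\<bar> \<le> 1 * (1 + \<tau> x)" for x
    using mult_left_mono[OF h1[of x] \<tau>_nonneg[of x]] \<tau>_nonneg[of x] by (simp add: abs_mult)
  then have int_\<tau>hP: "integrable lborel (\<lambda>x. \<tau> x * h x * P x)"
    by (intro int_P cont cont_\<tau> cont_h) 
  then have int_\<tau>ahP: "integrable lborel (\<lambda>x. \<tau> x * \<bar>h x\<bar> * P x)"
    using integrable_abs[of lborel "\<lambda>x. \<tau> x * h x * P x"] \<tau>_nonneg P_nonneg by (simp add: abs_mult)
  have int_wP: "integrable lborel (\<lambda>x. w x * P x)"
    using w1 by (intro int_P[where k = "2 * \<kappa>"] cont_w) simp
  \<comment> \<open>The dilation derivative of h P by the product rule: S and the term with p come
    from |f|^p, the term with \<gamma> from the weight, w P from h.\<close>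
  define D where "D x = S x - p * (\<tau> x * h x * P x) - \<gamma> * (h x * P x) + w x * P x" for x
  have int_D: "integrable lborel D"
    unfolding D_def by (intro Bochner_Integration.integrable_add Bochner_Integration.integrable_diff
        integrable_mult_right int_S int_\<tau>hP int_hP int_wP)
  have "(\<integral>x. n * (h x * P x) + D x \<partial>lborel) = 0"
    unfolding n_def
  proof (rule integral_dilation_derivative_eq_0[OF int_hP int_D])
    show "continuous_on (- {0}) D"
      unfolding D_def by (intro cont cont_S cont_\<tau> cont_h cont_P cont_w)
    fix x :: 'a assume x: "x \<noteq> 0"
    have "norm x powr (\<kappa> - 2) * (x \<bullet> x) = \<tau> x"
      using x by (simp add: \<tau>_def powr_diff powr_numeral dot_square_norm)
    then have "W x \<bullet> x = Du x \<bullet> x + u x * \<tau> x"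
      by (simp add: W_def inner_add_left mult.assoc)
    then have Wx: "Du x \<bullet> x - c * (- U x * \<tau> x) = W x \<bullet> x - f x * \<tau> x"
      by (simp add: f_def algebra_simps)
    have "((\<lambda>s. f (s *\<^sub>R x)) has_real_derivative W x \<bullet> x - f x * \<tau> x) (at 1)"
      unfolding f_def Wx[unfolded f_def \<tau>_def, symmetric] \<tau>_def
      by (intro DERIV_diff DERIV_u_ray DERIV_cmult DERIV_U_ray x)
    from DERIV_chain'[OF this DERIV_abs_powr[of p]] p
    have df: "((\<lambda>s. \<bar>f (s *\<^sub>R x)\<bar> powr p) has_real_derivative
       p * (sgn (f x) * \<bar>f x\<bar> powr (p - 1)) * (W x \<bullet> x - f x * \<tau> x)) (at 1)"
      by simp
    have "sgn (f x) * \<bar>f x\<bar> powr (p - 1) * f x = \<bar>f x\<bar> powr p" by (rule sgn_powr_mult)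
    then have "p * (sgn (f x) * \<bar>f x\<bar> powr (p - 1)) * (W x \<bullet> x - f x * \<tau> x)
      = p * (sgn (f x) * \<bar>f x\<bar> powr (p - 1)) * (W x \<bullet> x) - p * \<tau> x * \<bar>f x\<bar> powr p"
      by (simp add: right_diff_distrib mult_ac)
    note df = df[unfolded this]
    have d\<tau>: "((\<lambda>s. \<tau> (s *\<^sub>R x)) has_real_derivative \<kappa> * \<tau> x) (at 1)"
      unfolding \<tau>_def by (rule DERIV_norm_powr_ray[OF x])
    have dh: "((\<lambda>s. h (s *\<^sub>R x)) has_real_derivative w x) (at 1)"
      unfolding h_def using \<tau>1[of x]
      by (auto intro!: derivative_eq_intros d\<tau> simp: w_def power2_eq_square field_simps)
    from DERIV_mult[OF dh DERIV_mult[OF df DERIV_norm_powr_ray[OF x, of "- \<gamma>"]]]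
    show "((\<lambda>s. h (s *\<^sub>R x) * P (s *\<^sub>R x)) has_real_derivative D x) (at 1)"
      unfolding P_eq by (rule DERIV_cong) (simp add: D_def S_def P_eq algebra_simps)
  qed
  define Q where "Q x = lyapunov_density p (n - \<gamma>) \<kappa> (\<tau> x)" for x
  have Q_eq: "Q x * P x = p * (\<tau> x * h x * P x) - (p - 1) * (\<tau> x * \<bar>h x\<bar> * P x) - (n - \<gamma>) * (h x * P x) - w x * P x" for x
    unfolding Q_def lyapunov_density_def h_def[symmetric] w_def[symmetric] by (simp add: algebra_simps)
  have int_Q: "integrable lborel (\<lambda>x. Q x * P x)"
    unfolding Q_eq by (intro Bochner_Integration.integrable_diff
        integrable_mult_right int_\<tau>ahP int_\<tau>hP int_hP int_wP)
  then show "integrable lborel (\<lambda>x. lyapunov_density p (real DIM('a) - \<gamma>) \<kappa> (norm x powr \<kappa>) * P x)"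
    by (simp add: Q_def \<tau>_def n_def)
  have Young: "S x \<le> (p - 1) * (\<tau> x * \<bar>h x\<bar> * P x) + norm (W x) powr p * norm x powr - (p * b)" if x: "x \<noteq> 0" for x
  proof -
    define r where "r = norm x"
    have r: "0 < r" using x by (simp add: r_def)
    have "sgn (f x) * (W x \<bullet> x) * h x \<le> \<bar>sgn (f x) * (W x \<bullet> x) * h x\<bar>" by (rule abs_ge_self)
    also have "\<dots> \<le> 1 * (norm (W x) * r) * \<bar>h x\<bar>"
      unfolding abs_mult r_def by (intro mult_right_mono mult_mono Cauchy_Schwarz_ineq2) (auto simp: sgn_if)
    finally have "p * \<bar>f x\<bar> powr (p - 1) * r powr - \<gamma> * (sgn (f x) * (W x \<bullet> x) * h x)
      \<le> p * \<bar>f x\<bar> powr (p - 1) * r powr - \<gamma> * (1 * (norm (W x) * r) * \<bar>h x\<bar>)"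
      using p by (intro mult_left_mono) auto
    then have "S x \<le> \<bar>h x\<bar> * (p * \<bar>f x\<bar> powr (p - 1) * norm (W x) * (r * r powr - \<gamma>))"
      by (simp add: S_def mult_ac flip: r_def)
    \<comment> \<open>Since 1 - \<gamma> = -(p - 1) a - b, the weight splits so that Young's
      inequality pairs |f| r^(-a) with |W| r^(-b).\<close>
    also have "r * r powr - \<gamma> = (r powr - a) powr (p - 1) * r powr - b"
    proof -
      have "(r powr - a) powr (p - 1) * r powr - b = r powr (1 - \<gamma>)"
        by (simp add: powr_powr \<gamma>_def algebra_simps flip: powr_add)
      then show ?thesis using r by (simp add: powr_diff powr_minus field_simps)
    qed
    also have "p * \<bar>f x\<bar> powr (p - 1) * norm (W x) * ((r powr - a) powr (p - 1) * r powr - b)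
      = p * (\<bar>f x\<bar> * r powr - a) powr (p - 1) * (norm (W x) * r powr - b)"
      by (simp add: powr_mult mult_ac)
    also have "\<bar>h x\<bar> * \<dots> \<le> \<bar>h x\<bar> * ((p - 1) * (\<bar>f x\<bar> * r powr - a) powr p + (norm (W x) * r powr - b) powr p)"
      using p by (intro mult_left_mono Youngs_inequality_powr) auto
    \<comment> \<open>As -p a = \<kappa> - \<gamma>, this Young term is P with one extra factor
      \<tau>.\<close>
    also have "(\<bar>f x\<bar> * r powr - a) powr p = \<tau> x * P x"
    proof -
      have "\<kappa> - \<gamma> = - (p * a)" by (simp add: \<kappa>_def \<gamma>_def algebra_simps)
      then have "r powr - (p * a) = r powr \<kappa> * r powr - \<gamma>" by (simp flip: powr_add)
      then show ?thesis by (simp add: powr_mult powr_powr P_eq \<tau>_def r_def mult_ac)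
    qed
    also have "(norm (W x) * r powr - b) powr p = norm (W x) powr p * r powr - (p * b)"
      by (simp add: powr_mult powr_powr mult.commute)
    finally have "S x \<le> (p - 1) * (\<tau> x * \<bar>h x\<bar> * P x) + \<bar>h x\<bar> * (norm (W x) powr p * r powr - (p * b))"
      by (simp add: algebra_simps)
    also have "\<bar>h x\<bar> * (norm (W x) powr p * r powr - (p * b)) \<le> 1 * (norm (W x) powr p * r powr - (p * b))"
      using h1 by (intro mult_right_mono) auto
    finally show ?thesis by (simp add: r_def)
  qed
  \<comment> \<open>The added integral is zero. In the sum the terms with h P, \<tau> h P and w P
    cancel, leaving S - (p - 1) \<tau> |h| P, which \<open>Young\<close> bounds by the energy
    density.\<close>
  have "(\<integral>x. Q x * P x \<partial>lborel) = (\<integral>x. Q x * P x + (n * (h x * P x) + D x) \<partial>lborel)"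
    using \<open>(\<integral>x. n * (h x * P x) + D x \<partial>lborel) = 0\<close> int_Q int_hP int_D by simp
  also have "\<dots> \<le> energy"
    unfolding energy_def
  proof (rule integral_mono_AE)
    show "AE x in lborel. Q x * P x + (n * (h x * P x) + D x) \<le> norm (W x) powr p * norm x powr - (p * b)"
    proof (rule eventually_mono[OF AE_lborel_singleton[of 0]])
      fix x :: 'a assume "x \<noteq> 0"
      from Young[OF this] show "Q x * P x + (n * (h x * P x) + D x) \<le> norm (W x) powr p * norm x powr - (p * b)"
        unfolding Q_eq D_def by (simp add: algebra_simps)
    qed
  qed (use int_Q int_hP int_D integrable_energy in auto)
  finally show "(\<integral>x. lyapunov_density p (real DIM('a) - \<gamma>) \<kappa> (norm x powr \<kappa>) * P x \<partial>lborel) \<le> energy"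
    by (simp add: Q_def \<tau>_def n_def)
qed

section \<open>The quotient \<open>u / U\<close> and the reduction to a ball\<close>

definition v :: "'a \<Rightarrow> real" where "v x = u x / U x"

definition V :: "'a \<Rightarrow> 'a" where "V x = W x /\<^sub>R U x"

text \<open>Near the origin v is zero, so any lack of smoothness of U there is harmless. Elsewhere v
  = u exp(r^\<kappa> / \<kappa>), and differentiating the exponential produces the term u
  r^(\<kappa>-2) x of W.\<close>

lemma has_derivative_v: "(v has_derivative (\<lambda>h. V x \<bullet> h)) (at x)"
proof (cases "x = 0")
  case True
  have "((\<lambda>_. 0) has_derivative (\<lambda>h. V x \<bullet> h)) (at x)"
    using True \<rho> by (simp add: V_def W_0)
  then show ?thesis
    by (rule has_derivative_transform_within_open[where s = "ball 0 \<rho>"])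
       (use True \<rho> in \<open>auto simp: v_def u_0\<close>)
next
  case False
  define r where "r = norm x"
  have r: "0 < r" using False by (simp add: r_def)
  have v_eq: "v = (\<lambda>x. u x * exp (norm x powr \<kappa> / \<kappa>))"
    by (simp add: v_def U_def fun_eq_iff exp_minus field_simps)
  have "((\<lambda>s. exp (s powr \<kappa> / \<kappa>)) has_real_derivative exp (r powr \<kappa> / \<kappa>) * r powr (\<kappa> - 1)) (at r)"
    using r \<kappa> by (auto intro!: derivative_eq_intros)
  then have "((\<lambda>s. exp (s powr \<kappa> / \<kappa>)) has_derivative (*) (exp (r powr \<kappa> / \<kappa>) * r powr (\<kappa> - 1))) (at (norm x))"
    by (simp add: has_field_derivative_def r_def)
  from has_derivative_compose[OF has_derivative_norm[OF False] this]
  have "((\<lambda>x. exp (norm x powr \<kappa> / \<kappa>)) has_derivative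
      (\<lambda>h. exp (r powr \<kappa> / \<kappa>) * r powr (\<kappa> - 1) * (h \<bullet> sgn x))) (at x)" .
  from has_derivative_mult[OF deriv this]
  have "(v has_derivative (\<lambda>h. u x * (exp (r powr \<kappa> / \<kappa>) * r powr (\<kappa> - 1) * (h \<bullet> sgn x))
      + (Du x \<bullet> h) * exp (r powr \<kappa> / \<kappa>))) (at x)"
    by (simp add: v_eq r_def)
  moreover have "u x * (exp (r powr \<kappa> / \<kappa>) * r powr (\<kappa> - 1) * (h \<bullet> sgn x))
      + (Du x \<bullet> h) * exp (r powr \<kappa> / \<kappa>) = V x \<bullet> h" for h
  proof -
    have "r powr (\<kappa> - 1) * (h \<bullet> sgn x) = r powr (\<kappa> - 2) * (x \<bullet> h)"
      using r by (simp add: sgn_div_norm powr_diff powr_numeral power2_eq_square inner_commute field_simps flip: r_def)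
    then have "u x * (exp (r powr \<kappa> / \<kappa>) * r powr (\<kappa> - 1) * (h \<bullet> sgn x))
      = u x * exp (r powr \<kappa> / \<kappa>) * (r powr (\<kappa> - 2) * (x \<bullet> h))"
      by (simp only: mult.assoc)
    moreover have "V x = exp (r powr \<kappa> / \<kappa>) *\<^sub>R W x"
      by (simp add: V_def U_def exp_minus flip: r_def)
    ultimately show ?thesis
      by (simp only:) (simp add: W_def inner_add_left distrib_left flip: r_def)
  qed
  ultimately show ?thesis by simp
qed

lemma cont_V: "continuous_on UNIV V"
proof -
  have "continuous_on (- {0}) V"
    unfolding V_def using U_pos by (intro continuous_intros cont_W cont_U) (auto simp: less_imp_neq[symmetric])
  moreover have "continuous_on (ball 0 \<rho>) V"
    by (rule continuous_on_eq[OF continuous_on_const[of _ 0]]) (simp add: V_def W_0)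
  ultimately have "continuous_on (- {0} \<union> ball 0 \<rho>) V"
    by (intro continuous_on_open_Un) auto
  moreover have "- {0} \<union> ball 0 \<rho> = (UNIV :: 'a set)" using \<rho> by auto
  ultimately show ?thesis by simp
qed

text \<open>On the ball 1 / U is at most exp(R^\<kappa> / \<kappa>), and 1 <= R^(p b) r^(-p b) off
  the origin as p b >= 0; dropping the weight costs only a constant.\<close>

lemma ball_gradient_le_energy:
  assumes R: "0 < R"
  shows "(\<integral>x. indicator (cball 0 R) x * norm (V x) powr p \<partial>lborel)
    \<le> R powr (p * b) * exp (p * (R powr \<kappa> / \<kappa>)) * energy"
  unfolding energy_def integral_mult_right_zero[symmetric]
proof (rule integral_mono)
  have "integrable lborel (\<lambda>x. indicator (cball 0 R) x *\<^sub>R (norm (V x) powr p))"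
    using p by (intro borel_integrable_compact continuous_on_powr' continuous_on_subset[OF cont_V] continuous_intros) auto
  then show "integrable lborel (\<lambda>x. indicator (cball 0 R) x * norm (V x) powr p)" by simp
  show "integrable lborel (\<lambda>x. R powr (p * b) * exp (p * (R powr \<kappa> / \<kappa>)) * (norm (W x) powr p * norm x powr - (p * b)))"
    by (intro integrable_mult_right integrable_energy)
  fix x :: 'a
  show "indicator (cball 0 R) x * norm (V x) powr p
    \<le> R powr (p * b) * exp (p * (R powr \<kappa> / \<kappa>)) * (norm (W x) powr p * norm x powr - (p * b))"
  proof (cases "x \<noteq> 0 \<and> norm x \<le> R")
    case True
    have "norm x powr (p * b) \<le> R powr (p * b)"
      using True p b by (intro powr_mono2) auto
    then have 1: "1 \<le> R powr (p * b) * norm x powr - (p * b)"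
      using True by (simp add: powr_minus field_simps)
    have "norm x powr \<kappa> \<le> R powr \<kappa>" using True \<kappa> by (intro powr_mono2) auto
    then have "p * (norm x powr \<kappa> / \<kappa>) \<le> p * (R powr \<kappa> / \<kappa>)"
      using p \<kappa> by (intro mult_left_mono divide_right_mono) auto
    then have 2: "exp (p * (norm x powr \<kappa> / \<kappa>)) \<le> exp (p * (R powr \<kappa> / \<kappa>))" by simp
    have "norm (V x) = exp (norm x powr \<kappa> / \<kappa>) * norm (W x)"
      by (simp add: V_def U_def exp_minus)
    then have "norm (V x) powr p = exp (p * (norm x powr \<kappa> / \<kappa>)) * norm (W x) powr p"
      by (simp add: powr_mult) (simp add: powr_def)
    also have "\<dots> \<le> exp (p * (R powr \<kappa> / \<kappa>)) * norm (W x) powr p * 1"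
      using 2 by (simp add: mult_right_mono)
    also have "\<dots> \<le> exp (p * (R powr \<kappa> / \<kappa>)) * norm (W x) powr p * (R powr (p * b) * norm x powr - (p * b))"
      by (rule mult_left_mono[OF 1]) simp
    finally show ?thesis using True by (simp add: mult_ac)
  next
    case False
    then show ?thesis using W_0[of 0] \<rho> by (auto simp: V_def indicator_def)
  qed
qed

text \<open>The correction lives on \<tau> <= T, that is on a ball of radius T^(1/\<kappa>), where
  its factor r^\<gamma> cancels the weight of P. There |u - c U| = U |v - c| <= |v - c|.\<close>

lemma Lyapunov_ball:
  fixes c :: real
  assumes MT: "0 < M" "0 < T"
    "\<And>\<tau>. 0 \<le> \<tau> \<Longrightarrow> (real DIM('a) - \<gamma>) / 2 \<le>
       lyapunov_density p (real DIM('a) - \<gamma>) \<kappa> \<tau> + (if \<tau> \<le> T then M * \<tau> powr (\<gamma> / \<kappa>) else 0)"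
  shows "(real DIM('a) - \<gamma>) / 2 * (\<integral>x. \<bar>u x - c * U x\<bar> powr p / norm x powr \<gamma> \<partial>lborel)
    \<le> energy + M * (\<integral>x. indicator (cball 0 (T powr (1 / \<kappa>))) x * \<bar>v x - c\<bar> powr p \<partial>lborel)"
proof -
  define m where "m = real DIM('a) - \<gamma>"
  define P where "P x = \<bar>u x - c * U x\<bar> powr p * norm x powr - \<gamma>" for x
  define Q where "Q x = lyapunov_density p m \<kappa> (norm x powr \<kappa>)" for x :: 'a
  define R where "R = T powr (1 / \<kappa>)"
  define B where "B x = indicator (cball 0 R) x * \<bar>v x - c\<bar> powr p" for x
  note L = Lyapunov_inequality[of c, folded P_def m_def, folded Q_def]
  have "integrable lborel (\<lambda>x. indicator (cball 0 R) x *\<^sub>R (\<bar>v x - c\<bar> powr p))"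
    using p has_derivative_continuous[OF has_derivative_v]
    by (intro borel_integrable_compact continuous_on_powr' continuous_intros continuous_at_imp_continuous_on ballI) auto
  then have B: "integrable lborel B" by (simp add: B_def[abs_def])
  have "(m / 2) * (\<integral>x. P x \<partial>lborel) = (\<integral>x. (m / 2) * P x \<partial>lborel)" by simp
  also have "\<dots> \<le> (\<integral>x. Q x * P x + M * B x \<partial>lborel)"
  proof (rule integral_mono_AE)
    show "AE x in lborel. (m / 2) * P x \<le> Q x * P x + M * B x"
    proof (rule eventually_mono[OF AE_lborel_singleton[of 0]])
      fix x :: 'a assume x: "x \<noteq> 0"
      have P: "0 \<le> P x" by (simp add: P_def)
      have *: "(m / 2) * P x \<le> (Q x + (if norm x powr \<kappa> \<le> T then M * (norm x powr \<kappa>) powr (\<gamma> / \<kappa>) else 0)) * P x"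
        using MT(3)[of "norm x powr \<kappa>"] P unfolding Q_def m_def by (intro mult_right_mono) auto
      show "(m / 2) * P x \<le> Q x * P x + M * B x"
      proof (cases "norm x powr \<kappa> \<le> T")
        case True
        have "(norm x powr \<kappa>) powr (1 / \<kappa>) \<le> R"
          unfolding R_def using True \<kappa> by (intro powr_mono2) auto
        then have "norm x \<le> R" using \<kappa> by (simp add: powr_powr)
        have "(norm x powr \<kappa>) powr (\<gamma> / \<kappa>) * P x = \<bar>u x - c * U x\<bar> powr p"
          using \<kappa> x by (simp add: P_def powr_powr powr_minus)
        also have "u x - c * U x = U x * (v x - c)"
          using U_pos[of x] by (simp add: v_def field_simps)
        also have "\<bar>U x * (v x - c)\<bar> powr p \<le> \<bar>v x - c\<bar> powr p"
          using U_pos[of x] U_le_1[of x] p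
          by (intro powr_mono2) (auto simp: abs_mult intro!: mult_left_le_one_le)
        finally have "M * ((norm x powr \<kappa>) powr (\<gamma> / \<kappa>) * P x) \<le> M * B x"
          using \<open>norm x \<le> R\<close> MT(1) by (simp add: B_def)
        then show ?thesis using * True by (simp add: algebra_simps)
      next
        case False
        moreover have "0 \<le> M * B x" using MT(1) by (simp add: B_def)
        ultimately show ?thesis using * by simp
      qed
    qed
  qed (use L B in auto)
  also have "\<dots> \<le> energy + M * (\<integral>x. B x \<partial>lborel)"
    using L B by simp
  finally have "(m / 2) * (\<integral>x. P x \<partial>lborel) \<le> energy + M * (\<integral>x. B x \<partial>lborel)" .
  moreover have "P = (\<lambda>x. \<bar>u x - c * U x\<bar> powr p / norm x powr \<gamma>)"
    by (simp add: P_def powr_minus_divide fun_eq_iff)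
  ultimately show ?thesis
    by (simp only: m_def B_def R_def)
qed

lemma Inf_distance_le_energy:
  assumes MT: "0 < M" "0 < T"
    "\<And>\<tau>. 0 \<le> \<tau> \<Longrightarrow> (real DIM('a) - \<gamma>) / 2 \<le>
       lyapunov_density p (real DIM('a) - \<gamma>) \<kappa> \<tau> + (if \<tau> \<le> T then M * \<tau> powr (\<gamma> / \<kappa>) else 0)"
  defines "R \<equiv> T powr (1 / \<kappa>)"
  shows "(real DIM('a) - \<gamma>) / 2 * (INF c. \<integral>x. \<bar>u x - c * U x\<bar> powr p / norm x powr \<gamma> \<partial>lborel)
    \<le> (1 + M * (2 ^ DIM('a) * (2 * R) powr p * (R powr (p * b) * exp (p * (R powr \<kappa> / \<kappa>))))) * energy"
proof -
  define m where "m = real DIM('a) - \<gamma>"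
  define I where "I = (INF c. \<integral>x. \<bar>u x - c * U x\<bar> powr p / norm x powr \<gamma> \<partial>lborel)"
  have R: "0 < R" using MT by (simp add: R_def)
  \<comment> \<open>The integrals are nonnegative, so the family is bounded below and the real
    \<open>INF\<close> lies below each member.\<close>
  have I: "I \<le> (\<integral>x. \<bar>u x - c * U x\<bar> powr p / norm x powr \<gamma> \<partial>lborel)" for c
    unfolding I_def by (rule cINF_lower) (auto intro!: bdd_belowI[of _ 0] integral_nonneg_AE)
  \<comment> \<open>Each value v y is an admissible c, so \<open>Lyapunov_ball\<close> makes this
    one number a lower bound for every y, as \<open>Poincare_cball\<close> requires. It may be
    negative.\<close>
  have "((m / 2) * I - energy) / M \<le> 2 ^ DIM('a) * (2 * R) powr p * (\<integral>x. indicator (cball 0 R) x * norm (V x) powr p \<partial>lborel)"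
  proof (rule Poincare_cball[OF _ R has_derivative_v cont_V])
    fix y :: 'a
    have "(m / 2) * I \<le> (m / 2) * (\<integral>x. \<bar>u x - v y * U x\<bar> powr p / norm x powr \<gamma> \<partial>lborel)"
      using I \<gamma> by (intro mult_left_mono) (auto simp: m_def)
    also have "\<dots> \<le> energy + M * (\<integral>x. indicator (cball 0 R) x * \<bar>v x - v y\<bar> powr p \<partial>lborel)"
      using Lyapunov_ball[OF MT] by (simp add: m_def R_def)
    finally show "((m / 2) * I - energy) / M \<le> (\<integral>x. indicator (cball 0 R) x * \<bar>v x - v y\<bar> powr p \<partial>lborel)"
      using MT(1) by (simp add: field_simps)
  qed (use p in auto)
  also have "\<dots> \<le> 2 ^ DIM('a) * (2 * R) powr p * (R powr (p * b) * exp (p * (R powr \<kappa> / \<kappa>)) * energy)"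
    by (intro mult_left_mono ball_gradient_le_energy R) auto
  finally have "(m / 2) * I - energy \<le> 2 ^ DIM('a) * (2 * R) powr p * (R powr (p * b) * exp (p * (R powr \<kappa> / \<kappa>)) * energy) * M"
    using MT(1) by (simp add: pos_divide_le_eq)
  then show ?thesis
    unfolding I_def m_def by (simp add: algebra_simps)
qed

end

section \<open>Choice of the constant and conclusion\<close>

theorem theorem1p9:
  fixes N :: nat and p b :: real
  assumes "N = CARD('n::finite)"
    and "2 \<le> p" and "p < real N"
    and "0 \<le> b" and "b < (real N - p) / p"
  shows "\<exists>C>0. \<forall>a::real.
    a < real N * b / (real N - p) \<longrightarrow>
    (p - 1) * a + b + 1 = p * b * real N / (real N - p) \<longrightarrow>
    (\<forall>u \<in> (test_functions_punctured :: (real^'n \<Rightarrow> real) set).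
      (\<integral>x. norm (gradient u x) powr p / norm x powr (p * b) \<partial>lborel)
      + (p - 1) * (\<integral>x. \<bar>u x\<bar> powr p / norm x powr (p * a) \<partial>lborel)
      - (real N - (p - 1) * a - b - 1)
          * (\<integral>x. \<bar>u x\<bar> powr p / norm x powr ((p - 1) * a + b + 1) \<partial>lborel)
      \<ge> C * (INF c::real. \<integral>x. \<bar>u x - c * exp (- (norm x powr (b - a + 1)) / (b - a + 1))\<bar> powr p
                / norm x powr ((p - 1) * a + b + 1) \<partial>lborel))"
proof -
  define \<gamma> where "\<gamma> = p * b * real N / (real N - p)"
  \<comment> \<open>The equation between the parameters determines a from N, p and b. Computing its
    value here lets the constant be fixed before a is introduced.\<close>
  define a0 where "a0 = (\<gamma> - b - 1) / (p - 1)"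
  define \<kappa> where "\<kappa> = b - a0 + 1"
  define m where "m = real N - \<gamma>"
  have a0: "(p - 1) * a0 = \<gamma> - b - 1" using assms(2) by (simp add: a0_def)
  have Np: "0 < real N - p" "p * b < real N - p"
    using assms(2,3,5) by (auto simp: field_simps)
  have \<gamma>: "0 \<le> \<gamma>" using assms(2,4) Np by (simp add: \<gamma>_def)
  have "p * b * real N < (real N - p) * real N"
    using Np assms(2,3) by (intro mult_strict_right_mono) auto
  then have m: "0 < m" using Np by (simp add: m_def \<gamma>_def pos_divide_less_eq mult.commute)
  \<comment> \<open>This quantity equals (p - 1) \<kappa>; the upper bound on b makes it positive,
    which gives \<kappa> > 0.\<close>
  have "p * b + p - \<gamma> = (real N - p - p * b) * p / (real N - p)"
    using Np by (simp add: \<gamma>_def field_simps)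
  also have "\<dots> > 0" using Np assms(2) by simp
  finally have "0 < p * b + p - \<gamma>" .
  moreover have "(p - 1) * \<kappa> = p * b + p - \<gamma>"
    using a0 by (simp add: \<kappa>_def algebra_simps)
  ultimately have "0 < (p - 1) * \<kappa>" by simp
  then have \<kappa>: "0 < \<kappa>" using assms(2) by (simp add: zero_less_mult_iff)
  obtain M T where MT: "0 < M" "0 < T"
    "\<And>\<tau>. 0 \<le> \<tau> \<Longrightarrow> m / 2 \<le> lyapunov_density p m \<kappa> \<tau> + (if \<tau> \<le> T then M * \<tau> powr (\<gamma> / \<kappa>) else 0)"
    using lyapunov_density_ge[of p m \<kappa> "\<gamma> / \<kappa>"] assms(2) m \<kappa> \<gamma> by auto
  define R where "R = T powr (1 / \<kappa>)"
  define K where "K = 1 + M * (2 ^ N * (2 * R) powr p * (R powr (p * b) * exp (p * (R powr \<kappa> / \<kappa>))))"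
  have K: "0 < K" unfolding K_def using MT by (intro add_pos_nonneg) auto
  show ?thesis
  \<comment> \<open>The factor 2^(1-p) comes from the convexity gap; the rest turns (m / 2) INF <= K
    energy into a lower bound for the energy.\<close>
  proof (intro exI[of _ "2 powr (1 - p) * (m / 2 / K)"] conjI allI impI ballI)
    show "0 < 2 powr (1 - p) * (m / 2 / K)" using m K by simp
    fix a :: real and u :: "real^'n \<Rightarrow> real"
    assume "(p - 1) * a + b + 1 = p * b * real N / (real N - p)"
    then have g: "(p - 1) * a + b + 1 = \<gamma>" by (simp add: \<gamma>_def)
    then have g': "real N - (p - 1) * a - b - 1 = real N - \<gamma>" by simp
    from g have "a = a0" using assms(2) by (simp add: a0_def field_simps)
    then have k: "b - a + 1 = \<kappa>" by (simp add: \<kappa>_def)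
    assume u: "u \<in> test_functions_punctured"
    then have "smooth u" by (simp add: test_functions_punctured_def)
    obtain \<rho> \<sigma> where \<rho>: "0 < \<rho>"
      "\<And>x. norm x < \<rho> \<or> \<sigma> < norm x \<Longrightarrow> u x = 0"
      "\<And>x. norm x < \<rho> \<or> \<sigma> < norm x \<Longrightarrow> gradient u x = 0"
      using test_functions_punctured_annulus[OF u] by blast
    interpret annular_function u "gradient u" \<rho> \<sigma> p a b \<gamma> \<kappa>
      using smooth_gradient[OF \<open>smooth u\<close>] \<rho> assms g k \<gamma> m \<kappa>
      by unfold_locales (auto simp: m_def)
    have N: "N = DIM(real^'n)" using assms(1) by simp
    have I: "m / 2 * (INF c. \<integral>x. \<bar>u x - c * U x\<bar> powr p / norm x powr \<gamma> \<partial>lborel) \<le> K * energy"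
      using Inf_distance_le_energy[OF MT[unfolded m_def N]] unfolding K_def R_def m_def N .
    have "2 powr (1 - p) * (m / 2 / K) * (INF c. \<integral>x. \<bar>u x - c * U x\<bar> powr p / norm x powr \<gamma> \<partial>lborel)
      \<le> 2 powr (1 - p) * energy"
      using I K by (simp add: field_simps)
    also note energy_le_deficit
    finally show "(\<integral>x. norm (gradient u x) powr p / norm x powr (p * b) \<partial>lborel)
      + (p - 1) * (\<integral>x. \<bar>u x\<bar> powr p / norm x powr (p * a) \<partial>lborel)
      - (real N - (p - 1) * a - b - 1)
          * (\<integral>x. \<bar>u x\<bar> powr p / norm x powr ((p - 1) * a + b + 1) \<partial>lborel)
      \<ge> 2 powr (1 - p) * (m / 2 / K) * (INF c::real. \<integral>x. \<bar>u x - c * exp (- (norm x powr (b - a + 1)) / (b - a + 1))\<bar> powr p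
                / norm x powr ((p - 1) * a + b + 1) \<partial>lborel)"
      unfolding g' g k unfolding N U_def .
  qed
qed

end
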